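(* There exists an absolute constant $C>0$ such that for every sufficiently large integer $n$ there exists an $n$-vertex graph $G$ with $$\chi_f(G)\ge \frac{\log n}{C\log\log n}\quad\text{and}\quad \rho(G)\le C(\log\log n)^2.$$ Hence, denoting by $g(n)$ the maximum of the ratio $\frac{\chi_f(G)}{\rho(G)}$ over all $n$-vertex graphs $G$, we have $g(n)=\Omega\left(\frac{\log n}{(\log\log n)^3}\right)$ as $n\to\infty$, and thus $g(n)=(\log n)^{1-o(1)}$ as $n\to\infty$.
   Context: All graphs are finite and simple, with at least one vertex. $\log$ denotes the natural logarithm. For a graph $G$, $\mathcal{I}(G)$ denotes the collection of independent sets of $G$ and $\alpha(G)$ the maximum size of an independent set. The fractional chromatic number $\chi_f(G)$ is the optimal value of the linear program: minimize $\sum_{I\in\mathcal{I}(G)}x_I$ subject to $\sum_{I\in\mathcal{I}(G):\, v\in I}x_I\ge 1$ for all $v\in V(G)$ and $x_I\ge 0$ for all $I\in\mathcal{I}(G)$. Equivalently, $\chi_f(G)=\max_w \frac{\sum_{v\in V(G)}w(v)}{\alpha_w(G)}$, the maximum being over all $w:V(G)\to[0,\infty)$ with $w\not\equiv 0$, where $\alpha_w(G)=\max_{I\in\mathcal{I}(G)}\sum_{v\in I}w(v)$. The Hall ratio of $G$ is $\rho(G)=\max_{H\subseteq G}\frac{|V(H)|}{\alpha(H)}$, the maximum being over all subgraphs $H$ of $G$ with at least one vertex. *)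

theory Defs
  imports
    Complex_Main
    "HOL-Library.Landau_Symbols"
    "Graph_Theory.Digraph_Component"
begin

(* A finite simple graph is a pair_graph of the entry Graph_Theory: a finite vertex set with a
   symmetric, irreflexive adjacency relation (each edge uv occurs as the two arcs (u,v), (v,u)).
   That locale admits the null graph, which is excluded here. *)
definition finite_simple_graph :: "'a pair_pre_digraph \<Rightarrow> bool" where
  "finite_simple_graph G \<longleftrightarrow> pair_graph G \<and> pverts G \<noteq> {}"

definition independent_sets :: "'a pair_pre_digraph \<Rightarrow> 'a set set" where
  "independent_sets G = {I. I \<subseteq> pverts G \<and> (\<forall>u\<in>I. \<forall>v\<in>I. (u, v) \<notin> parcs G)}"

definition independence_number :: "'a pair_pre_digraph \<Rightarrow> nat" where
  "independence_number G = Max (card ` independent_sets G)"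

definition fractional_colouring :: "'a pair_pre_digraph \<Rightarrow> ('a set \<Rightarrow> real) \<Rightarrow> bool" where
  "fractional_colouring G x \<longleftrightarrow>
     (\<forall>v\<in>pverts G. (\<Sum>I | I \<in> independent_sets G \<and> v \<in> I. x I) \<ge> 1) \<and>
     (\<forall>I\<in>independent_sets G. x I \<ge> 0)"

(* The linear program is feasible and its objective is bounded below by 0. *)
definition fractional_chromatic_number :: "'a pair_pre_digraph \<Rightarrow> real" where
  "fractional_chromatic_number G =
     Inf {\<Sum>I\<in>independent_sets G. x I | x. fractional_colouring G x}"

definition hall_ratio :: "'a pair_pre_digraph \<Rightarrow> real" where
  "hall_ratio G =
     Max {real (card (pverts H)) / real (independence_number H) | H.
            finite_simple_graph H \<and> subgraph (with_proj H) (with_proj G)}"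

definition n_vertex_graph :: "nat \<Rightarrow> 'a pair_pre_digraph \<Rightarrow> bool" where
  "n_vertex_graph n G \<longleftrightarrow> finite_simple_graph G \<and> card (pverts G) = n"

(* Vertices are natural numbers, which covers all finite graphs up to isomorphism. There are
   infinitely many such graphs on n vertices but only finitely many isomorphism classes, so for
   n > 0 the set below is finite and nonempty; for n = 0 it is empty and the value is unspecified. *)
definition max_chi_hall_ratio :: "nat \<Rightarrow> real" where
  "max_chi_hall_ratio n =
     Max {fractional_chromatic_number G / hall_ratio G | G :: nat pair_pre_digraph.
            n_vertex_graph n G}"

end

theory Submission
  imports Defs "HOL-Real_Asymp.Real_Asymp"
begin

text \<open>The graph has \<open>k\<close> levels. Level \<open>i\<close> has \<open>D ^ (i + 1)\<close> vertices, where \<open>D = 8 * k\<close>, and two vertices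
of levels \<open>i < j\<close> are joined at random with probability \<open>1 / D ^ i\<close>; so a vertex expects \<open>D\<close>
neighbours in every lower level. All remaining vertices are isolated. About \<open>D ^ k\<close> vertices are
used, so \<open>k\<close> can be chosen of order \<open>log n / log log n\<close>.

The fractional chromatic number is bounded below by linear programming duality
(\<open>fractional_chromatic_number_ge_weight\<close>). A vertex of level \<open>i\<close> gets weight \<open>1 / D ^ (i + 1)\<close>, so
that each level has total weight 1. Suppose an independent set has weight above 3. The levels in
which it has density below \<open>1 / k\<close> contribute at most 1, so if \<open>j\<close> is the last of the other
levels, the part below level \<open>j\<close> has weight above 1. There are at most \<open>4 ^ N\<close> pairs of a
set below level \<open>j\<close> and a subset of level \<open>j\<close>, where \<open>N = D ^ (j + 1)\<close>, and a pair of this kind is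
free of edges with probability at most \<open>exp (- 8 * N)\<close>. With positive probability none of them is;
then every independent set has weight at most 3 (\<open>independent_weight_le\<close>), and the fractional chromatic number is at least
\<open>k / 3\<close>.

For the Hall ratio let \<open>H\<close> be a set of vertices and let \<open>q\<close> be least with \<open>card H \<le> D ^ q\<close>. Levels
much smaller than \<open>H\<close> contain only a small part of it, and the five levels of size close to
\<open>card H\<close> are independent. The larger levels are grouped into blocks \<open>q + u, \<dots>, q + 2 * u\<close> with
\<open>u = 2 ^ l - 1\<close>, of which there are \<open>O (log k)\<close>. For \<open>m \<le> D ^ q\<close> the choice of \<open>m\<close> vertices in such a
block and of three edges per vertex among them contributes, up to constants, a factor
\<open>D ^ (q + 2 * u + 1) / m * m ^ 3 \<le> D ^ (3 * q + 2 * u + 1)\<close> per vertex, whereas three given edges are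
present with probability at most \<open>1 / D ^ (3 * q + 3 * u)\<close>. Since \<open>u \<ge> 3\<close>, the union bound shows that
with positive probability every set of at most \<open>D ^ q\<close> vertices in the block spans fewer than three
edges per vertex (\<open>prob_some_dense_set\<close>). Such a set
contains a sixth of its vertices as an independent set, so some block, level or rest
of \<open>H\<close> provides an independent set of size at least \<open>card H / O (log k)\<close>
(\<open>large_independent_subset\<close>). Hence the Hall ratio is \<open>O (log log n)\<close>.

For the growth of the maximal ratio an upper bound is also needed. Repeatedly removing a largest independent set
covers \<open>G\<close> by at most \<open>(1 + log n)\<close> times its Hall ratio many independent sets
(\<open>greedy_cover\<close>), so the ratio never exceeds \<open>1 + log n\<close>. Both invariants are preserved by
isomorphisms, which makes the set of ratios attained by \<open>n\<close>-vertex graphs on natural numbers finite,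
and so gives meaning to its maximum.\<close>

section \<open>Random subsets and the union bound\<close>

text \<open>The weight of \<open>E\<close> is the probability that the random subset of \<open>P\<close>, which contains each \<open>e\<close>
independently with probability \<open>p e\<close>, equals \<open>E\<close>. The sum is the expansion of a product over \<open>P\<close>
in which the factor of every \<open>e \<in> F\<close> has lost its summand \<open>1 - p e\<close>.\<close>

lemma random_subset_contains:
  fixes p :: "'a \<Rightarrow> real"
  assumes "finite P" "F \<subseteq> P"
  shows "(\<Sum>E | E \<subseteq> P \<and> F \<subseteq> E. (\<Prod>e\<in>E. p e) * (\<Prod>e\<in>P - E. 1 - p e)) = (\<Prod>e\<in>F. p e)"
proof -
  define g where "g e = (if e \<in> F then 0 else 1 - p e)" for e
  have "(\<Prod>e\<in>F. p e) = (\<Prod>e\<in>P. p e + g e)"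
    using assms by (subst prod.subset_diff[of F P]) (auto simp: g_def)
  also have "\<dots> = (\<Sum>E\<in>Pow P. (\<Prod>e\<in>E. p e) * (\<Prod>e\<in>P - E. g e))"
    by (rule prod_add) fact
  also have "\<dots> = (\<Sum>E | E \<subseteq> P \<and> F \<subseteq> E. (\<Prod>e\<in>E. p e) * (\<Prod>e\<in>P - E. g e))"
    using assms by (intro sum.mono_neutral_right) (auto simp: g_def intro!: prod_zero)
  also have "\<dots> = (\<Sum>E | E \<subseteq> P \<and> F \<subseteq> E. (\<Prod>e\<in>E. p e) * (\<Prod>e\<in>P - E. 1 - p e))"
    by (intro sum.cong refl arg_cong2[where f = "(*)"] prod.cong) (auto simp: g_def)
  finally show ?thesis ..
qed

lemma random_subset_avoids:
  fixes p :: "'a \<Rightarrow> real"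
  assumes "finite P" "A \<subseteq> P"
  shows "(\<Sum>E | E \<subseteq> P \<and> A \<inter> E = {}. (\<Prod>e\<in>E. p e) * (\<Prod>e\<in>P - E. 1 - p e)) = (\<Prod>e\<in>A. 1 - p e)"
proof -
  define f where "f e = (if e \<in> A then 0 else p e)" for e
  have "(\<Prod>e\<in>A. 1 - p e) = (\<Prod>e\<in>P. f e + (1 - p e))"
    using assms by (subst prod.subset_diff[of A P]) (auto simp: f_def)
  also have "\<dots> = (\<Sum>E\<in>Pow P. (\<Prod>e\<in>E. f e) * (\<Prod>e\<in>P - E. 1 - p e))"
    by (rule prod_add) fact
  also have "\<dots> = (\<Sum>E | E \<subseteq> P \<and> A \<inter> E = {}. (\<Prod>e\<in>E. f e) * (\<Prod>e\<in>P - E. 1 - p e))"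
    using assms by (intro sum.mono_neutral_right)
      (auto simp: f_def intro!: prod_zero dest: finite_subset)
  also have "\<dots> = (\<Sum>E | E \<subseteq> P \<and> A \<inter> E = {}. (\<Prod>e\<in>E. p e) * (\<Prod>e\<in>P - E. 1 - p e))"
    by (intro sum.cong refl arg_cong2[where f = "(*)"] prod.cong) (auto simp: f_def)
  finally show ?thesis ..
qed

lemma sum_UN_le:
  fixes f :: "'b \<Rightarrow> real"
  assumes "finite I" "\<And>i. i \<in> I \<Longrightarrow> finite (A i)" "\<And>i x. i \<in> I \<Longrightarrow> x \<in> A i \<Longrightarrow> f x \<ge> 0"
  shows "sum f (\<Union>i\<in>I. A i) \<le> (\<Sum>i\<in>I. sum f (A i))"
proof -
  have "sum f (\<Union>i\<in>I. A i) \<le> (\<Sum>(i, x)\<in>Sigma I A. f x)"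
    using assms by (intro sum_le_included[where i = snd]) fastforce+
  then show ?thesis using assms by (simp add: sum.Sigma)
qed

text \<open>The first moment method: the total probability of the unwanted events is below 1, so some outcome
avoids them all. In the application \<open>P\<close> consists of the possible edges, the sets \<open>A i\<close> must receive an
edge, and the sets \<open>F j\<close> must not consist of edges only.\<close>

lemma exists_subset_hitting_and_not_containing:
  fixes p :: "'a \<Rightarrow> real"
  assumes P: "finite P" and p: "\<And>e. e \<in> P \<Longrightarrow> 0 \<le> p e \<and> p e \<le> 1"
    and A: "finite I" "\<And>i. i \<in> I \<Longrightarrow> A i \<subseteq> P"
    and F: "finite J" "\<And>j. j \<in> J \<Longrightarrow> F j \<subseteq> P"
    and small: "(\<Sum>i\<in>I. \<Prod>e\<in>A i. 1 - p e) + (\<Sum>j\<in>J. \<Prod>e\<in>F j. p e) < 1"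
  shows "\<exists>E\<subseteq>P. (\<forall>i\<in>I. A i \<inter> E \<noteq> {}) \<and> (\<forall>j\<in>J. \<not> F j \<subseteq> E)"
proof (rule ccontr)
  assume contra: "\<not> ?thesis"
  define \<mu> where "\<mu> E = (\<Prod>e\<in>E. p e) * (\<Prod>e\<in>P - E. 1 - p e)" for E
  let ?a = "\<lambda>i. {E. E \<subseteq> P \<and> A i \<inter> E = {}}" and ?b = "\<lambda>j. {E. E \<subseteq> P \<and> F j \<subseteq> E}"
  have nonneg: "\<mu> E \<ge> 0" if "E \<subseteq> P" for E
    unfolding \<mu>_def using that p by (intro mult_nonneg_nonneg prod_nonneg) auto
  have fin: "finite (Pow P)" "\<And>i. finite (?a i)" "\<And>j. finite (?b j)"
    using P by (auto intro: finite_subset[of _ "Pow P"])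
  have "1 = (\<Sum>E\<in>Pow P. \<mu> E)"
    using random_subset_contains[OF P, of "{}" p] by (simp add: \<mu>_def Pow_def)
  also have "\<dots> \<le> (\<Sum>E\<in>(\<Union>i\<in>I. ?a i) \<union> (\<Union>j\<in>J. ?b j). \<mu> E)"
    using contra A(1) F(1) fin nonneg by (intro sum_mono2) auto
  also have "\<dots> \<le> (\<Sum>E\<in>(\<Union>i\<in>I. ?a i). \<mu> E) + (\<Sum>E\<in>(\<Union>j\<in>J. ?b j). \<mu> E)"
    using A(1) F(1) fin nonneg by (subst sum_Un) (auto intro!: sum_nonneg)
  also have "\<dots> \<le> (\<Sum>i\<in>I. \<Sum>E\<in>?a i. \<mu> E) + (\<Sum>j\<in>J. \<Sum>E\<in>?b j. \<mu> E)"
    using A(1) F(1) fin nonneg by (intro add_mono sum_UN_le) auto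
  also have "\<dots> = (\<Sum>i\<in>I. \<Prod>e\<in>A i. 1 - p e) + (\<Sum>j\<in>J. \<Prod>e\<in>F j. p e)"
    unfolding \<mu>_def using A F P
    by (intro arg_cong2[where f = "(+)"] sum.cong random_subset_contains random_subset_avoids) auto
  finally show False using small by simp
qed

section \<open>Numerical and graph-theoretic estimates\<close>

text \<open>Since \<open>r ^ r / fact r\<close> is a single term of the series of \<open>exp r\<close>, it is at most \<open>3 ^ r\<close>.\<close>

lemma binomial_le_exp_bound:
  assumes "0 < r"
  shows "real (n choose r) \<le> (3 * real n / real r) ^ r"
proof -
  have "real r ^ r / fact r \<le> exp (real r)"
  proof -
    have "(\<lambda>i. real r ^ i /\<^sub>R fact i) sums exp (real r)" by (rule exp_converges)
    then have "(\<Sum>i\<in>{r}. real r ^ i /\<^sub>R fact i) \<le> exp (real r)"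
      using sum_le_suminf[of "\<lambda>i. real r ^ i /\<^sub>R fact i" "{r}"] by (auto simp: sums_iff)
    then show ?thesis by (simp add: field_simps)
  qed
  also have "\<dots> = exp 1 ^ r" by (simp flip: exp_of_nat_mult)
  also have "\<dots> \<le> 3 ^ r" by (intro power_mono exp_le) simp
  finally have r: "real r ^ r \<le> 3 ^ r * fact r" by (simp add: field_simps)
  have "real (n choose r) * fact r \<le> real n ^ r"
    using binomial_fact_pow[of n r] by (metis of_nat_fact of_nat_le_iff of_nat_mult of_nat_power)
  then have "real (n choose r) * real r ^ r \<le> 3 ^ r * real n ^ r"
    using mult_left_mono[OF r, of "real (n choose r)"] mult_left_mono[of _ "real n ^ r" "3 ^ r :: real"]
    by (smt (verit) mult.assoc mult.commute zero_le_power of_nat_0_le_iff)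
  then show ?thesis using assms by (simp add: power_divide power_mult_distrib field_simps)
qed

lemma geometric_sum_le_twice_first:
  fixes x :: real
  assumes "0 \<le> x" "x \<le> 1 / 2"
  shows "(\<Sum>m=1..M. x ^ m) \<le> 2 * x"
proof -
  have "(\<Sum>m=1..M. x ^ m) \<le> 2 * x - 2 * x ^ Suc M"
  proof (induction M)
    case (Suc M)
    have "x ^ Suc M * (x * 2) \<le> x ^ Suc M * 1" using assms by (intro mult_left_mono) auto
    with Suc show ?case by (simp add: algebra_simps)
  qed (use assms in simp)
  then show ?thesis using assms by (smt (verit) mult_nonneg_nonneg zero_le_power)
qed

text \<open>Some vertex has fewer than \<open>d\<close> neighbours, because the average is below \<open>d\<close>. Taking it and deleting it
together with its neighbours removes at most \<open>d\<close> vertices, and the hypothesis passes to what is left.\<close>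

lemma independent_subset_of_hereditarily_sparse:
  fixes V :: "'a set" and arcs :: "('a \<times> 'a) set"
  assumes "finite U" "\<And>T. T \<subseteq> U \<Longrightarrow> T \<noteq> {} \<Longrightarrow> card (arcs \<inter> T \<times> T) < d * card T"
    and sym: "sym arcs" and "irrefl arcs"
  shows "\<exists>I\<subseteq>U. (\<forall>u\<in>I. \<forall>v\<in>I. (u,v) \<notin> arcs) \<and> card U \<le> d * card I"
  using assms(1,2)
proof (induction "card U" arbitrary: U rule: less_induct)
  case less
  show ?case
  proof (cases "U = {}")
    case False
    have "\<exists>v\<in>U. card {u\<in>U. (v,u) \<in> arcs} < d"
    proof (rule ccontr)
      assume "\<not> ?thesis"
      then have "d * card U \<le> (\<Sum>v\<in>U. card {u\<in>U. (v,u) \<in> arcs})"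
        using sum_mono[of U "\<lambda>_. d" "\<lambda>v. card {u\<in>U. (v,u) \<in> arcs}"] by (force simp: mult.commute)
      also have "\<dots> = card (SIGMA v:U. {u\<in>U. (v,u) \<in> arcs})"
        using less.prems(1) by simp
      also have "(SIGMA v:U. {u\<in>U. (v,u) \<in> arcs}) = arcs \<inter> U \<times> U" by auto
      finally show False using less.prems(2)[of U] False by simp
    qed
    then obtain v where v: "v \<in> U" "card {u\<in>U. (v,u) \<in> arcs} < d" by blast
    define N where "N = insert v {u\<in>U. (v,u) \<in> arcs}"
    have N: "N \<subseteq> U" "card N \<le> d" "v \<in> N"
      using v less.prems(1) by (auto simp: N_def card_insert_if)
    have "card (U - N) < card U"
      using N v less.prems(1) by (intro psubset_card_mono) auto
    from less.hyps[OF this] less.prems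
    obtain I where I: "I \<subseteq> U - N" "\<forall>u\<in>I. \<forall>v\<in>I. (u,v) \<notin> arcs" "card (U - N) \<le> d * card I"
      by (metis (no_types, lifting) Diff_subset finite_Diff subset_trans)
    have fI: "finite I" "v \<notin> I" using I N less.prems(1) by (auto dest: finite_subset)
    have "card U \<le> card (U - N) + card N"
      using N less.prems(1) by (simp add: card_Diff_subset finite_subset)
    also have "\<dots> \<le> d * card (insert v I)"
      using I N fI by simp
    finally have "card U \<le> d * card (insert v I)" .
    moreover have "\<forall>a\<in>insert v I. \<forall>b\<in>insert v I. (a,b) \<notin> arcs"
      using I \<open>irrefl arcs\<close> sym by (auto simp: N_def irrefl_def dest: symD)
    ultimately show ?thesis using I v by (intro exI[of _ "insert v I"]) auto
  qed auto
qed

section \<open>A random graph on levels of geometrically growing size\<close>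

text \<open>Vertices of level \<open>k\<close> and above are the isolated ones that pad the vertex set to its prescribed size.\<close>

locale levelled_set =
  fixes X :: "'a set" and lev :: "'a \<Rightarrow> nat" and D k :: nat
  assumes finite_X: "finite X"
    and card_level: "\<And>i. i < k \<Longrightarrow> card {v \<in> X. lev v = i} = D ^ Suc i"
    and D_ge: "8 \<le> D" "8 * k \<le> D"
begin

definition level :: "nat \<Rightarrow> 'a set" where
  "level i = {v \<in> X. lev v = i}"

definition candidates :: "('a \<times> 'a) set" where
  "candidates = {(u, v). u \<in> X \<and> v \<in> X \<and> lev u < lev v \<and> lev v < k}"

text \<open>The probability depends on the lower end of the edge only: the expected number of neighbours of a
vertex is then the same, namely \<open>D\<close>, in each level below it.\<close>

definition prob :: "'a \<times> 'a \<Rightarrow> real" where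
  "prob e = 1 / real D ^ lev (fst e)"

text \<open>Normalised such that each level has total weight 1.\<close>

definition weight :: "'a set \<Rightarrow> real" where
  "weight S = (\<Sum>v\<in>S. 1 / real D ^ Suc (lev v))"

text \<open>For \<open>u = 2 ^ l - 1\<close> the blocks with \<open>l = 2, 3, \<dots>\<close> tile the levels from \<open>q + 3\<close> on.\<close>

definition block :: "nat \<Rightarrow> nat \<Rightarrow> 'a set" where
  "block q u = {v \<in> X. lev v < k \<and> q + u \<le> lev v \<and> lev v \<le> q + 2 * u}"

lemma finite_level [simp]: "finite (level i)"
  using finite_X by (simp add: level_def)

lemma card_levels_below: "card {v \<in> X. lev v < k \<and> lev v \<le> j} \<le> 2 * D ^ Suc j"
proof (induction j)
  case 0
  have "{v \<in> X. lev v < k \<and> lev v \<le> 0} = (if 0 < k then level 0 else {})"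
    by (auto simp: level_def)
  then show ?case using card_level[of 0] by (auto simp: level_def)
next
  case (Suc j)
  have eq: "{v \<in> X. lev v < k \<and> lev v \<le> Suc j} =
    {v \<in> X. lev v < k \<and> lev v \<le> j} \<union> (if Suc j < k then level (Suc j) else {})"
    by (auto simp: level_def le_Suc_eq)
  have "card {v \<in> X. lev v < k \<and> lev v \<le> Suc j} \<le> 2 * D ^ Suc j + D ^ Suc (Suc j)"
    unfolding eq using Suc card_level[of "Suc j"]
    by (intro order.trans[OF card_Un_le] add_mono) (auto simp: level_def)
  also have "2 * D ^ Suc j \<le> D * D ^ Suc j"
    using D_ge by (intro mult_right_mono) auto
  finally show ?case by simp
qed

lemma candidates_finite: "finite candidates"
  by (rule finite_subset[of _ "X \<times> X"]) (use finite_X in \<open>auto simp: candidates_def\<close>)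

lemma prob_bounds: "0 \<le> prob e" "prob e \<le> 1"
  using D_ge by (auto simp: prob_def field_simps)

text \<open>Every set of vertices that has weight above 3 in the levels below \<open>k\<close> contains both members of such a
pair \<open>(S, B)\<close>, with \<open>j\<close> the highest level in which the set has density at least \<open>1 / k\<close>.\<close>

definition heavy_pairs :: "(nat \<times> 'a set \<times> 'a set) set" where
  "heavy_pairs = {(j, S, B). j < k \<and> S \<subseteq> {v \<in> X. lev v < j} \<and> B \<subseteq> level j \<and>
     D ^ Suc j \<le> k * card B \<and> 1 \<le> weight S}"

lemma heavy_pairs_subset:
  "heavy_pairs \<subseteq> (SIGMA j:{..<k}. Pow {v \<in> X. lev v < j} \<times> Pow (level j))"
  by (auto simp: heavy_pairs_def)

lemma finite_heavy_pairs: "finite heavy_pairs"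
  by (rule finite_subset[OF heavy_pairs_subset]) (use finite_X in auto)

text \<open>The expected number of edges between \<open>S\<close> and \<open>B\<close> is \<open>card B * D * weight S\<close>, which is at least
\<open>8 * k * card B\<close>, and the probability of having none is at most the exponential of its negative.\<close>

lemma prob_heavy_pair_empty:
  assumes "(j, S, B) \<in> heavy_pairs"
  shows "(\<Prod>e\<in>S \<times> B. 1 - prob e) \<le> exp (- 8 * real D ^ Suc j)"
proof -
  have h: "S \<subseteq> X" "B \<subseteq> X" "D ^ Suc j \<le> k * card B" "1 \<le> weight S"
    using assms by (auto simp: heavy_pairs_def level_def)
  have fin: "finite S" "finite B" using h finite_X by (auto dest: finite_subset)
  have "8 * real D ^ Suc j \<le> 8 * (real k * real (card B))"
    using h(3) by (simp flip: of_nat_power of_nat_mult)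
  also have "\<dots> \<le> real D * real (card B)"
    using mult_right_mono[of "real (8 * k)" "real D" "real (card B)"] D_ge(2) by (simp add: mult.assoc)
  also have "\<dots> \<le> real (card B) * (real D * weight S)"
    using h(4) mult_left_mono[OF h(4), of "real D * real (card B)"] by (simp add: mult_ac)
  also have "\<dots> = (\<Sum>e\<in>S \<times> B. prob e)"
    using D_ge fin
    by (simp add: prob_def weight_def sum.cartesian_product' sum_distrib_left field_simps)
  finally have *: "8 * real D ^ Suc j \<le> (\<Sum>e\<in>S \<times> B. prob e)" .
  have "(\<Prod>e\<in>S \<times> B. 1 - prob e) \<le> (\<Prod>e\<in>S \<times> B. exp (- prob e))"
    using prob_bounds exp_ge_add_one_self[of "- prob _"] by (intro prod_mono) auto
  also have "\<dots> = exp (- (\<Sum>e\<in>S \<times> B. prob e))"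
    using fin by (subst sum_negf[symmetric], subst exp_sum) auto
  finally show ?thesis using * by (smt (verit) exp_le_cancel_iff)
qed

text \<open>For fixed \<open>j\<close> the sets \<open>S\<close> and \<open>B\<close> are determined by a subset of the levels up to \<open>j\<close>. The last of these
levels dominates the others in size, so the number of pairs is only \<open>4 ^ N\<close> with \<open>N = D ^ (j + 1)\<close>.\<close>

lemma prob_some_heavy_pair_empty:
  "(\<Sum>(j, S, B)\<in>heavy_pairs. \<Prod>e\<in>S \<times> B. 1 - prob e) \<le> 1 / 4"
proof -
  let ?Q = "SIGMA j:{..<k}. Pow {v \<in> X. lev v < j} \<times> Pow (level j)"
  have summand: "real (card (Pow {v \<in> X. lev v < j} \<times> Pow (level j))) * exp (- 8 * real D ^ Suc j)
      \<le> 1 / (4 * real k)" if "j < k" for j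
  proof -
    define N where "N = D ^ Suc j"
    (* The levels below j are disjoint from level j, so pairs of subsets correspond to
       subsets of the union. *)
    have "card {v \<in> X. lev v < j} + card (level j) = card ({v \<in> X. lev v < j} \<union> level j)"
      using finite_X by (subst card_Un_disjoint) (auto simp: level_def)
    also have "{v \<in> X. lev v < j} \<union> level j = {v \<in> X. lev v < k \<and> lev v \<le> j}"
      using that by (auto simp: level_def)
    also have "card \<dots> \<le> 2 * N" unfolding N_def by (rule card_levels_below)
    finally have "card (Pow {v \<in> X. lev v < j} \<times> Pow (level j)) \<le> 2 ^ (2 * N)"
      using finite_X by (simp add: card_cartesian_product card_Pow power_increasing flip: power_add)
    from of_nat_mono[OF this, where 'a = real]
    have "real (card (Pow {v \<in> X. lev v < j} \<times> Pow (level j))) \<le> 2 ^ (2 * N)"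
      by (simp only: of_nat_power of_nat_numeral)
    also have "(2::real) ^ (2 * N) \<le> exp 1 ^ (2 * N)"
      using exp_ge_add_one_self[of 1] by (intro power_mono) auto
    also have "\<dots> = exp (2 * real N)" by (simp flip: exp_of_nat_mult)
    finally have "real (card (Pow {v \<in> X. lev v < j} \<times> Pow (level j))) * exp (- 8 * real N)
        \<le> exp (2 * real N) * exp (- 8 * real N)" by (intro mult_right_mono) auto
    also have "\<dots> = 1 / exp (6 * real N)" by (simp add: exp_minus field_simps flip: exp_add)
    also have "\<dots> \<le> 1 / (4 * real k)"
    proof (intro divide_left_mono mult_pos_pos)
      have "D \<le> N" unfolding N_def using D_ge by simp
      then have "4 * real k \<le> 6 * real N" using D_ge by linarith
      then show "4 * real k \<le> exp (6 * real N)"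
        using exp_ge_add_one_self[of "6 * real N"] by linarith
    qed (use that in auto)
    finally show ?thesis by (simp add: N_def)
  qed
  have "(\<Sum>(j, S, B)\<in>heavy_pairs. \<Prod>e\<in>S \<times> B. 1 - prob e)
      \<le> (\<Sum>(j, S, B)\<in>heavy_pairs. exp (- 8 * real D ^ Suc j))"
    by (intro sum_mono) (use prob_heavy_pair_empty in auto)
  also have "\<dots> \<le> (\<Sum>(j, S, B)\<in>?Q. exp (- 8 * real D ^ Suc j))"
    using heavy_pairs_subset finite_X by (intro sum_mono2) auto
  also have "\<dots> = (\<Sum>j<k. real (card (Pow {v \<in> X. lev v < j} \<times> Pow (level j))) * exp (- 8 * real D ^ Suc j))"
    using finite_X by (subst sum.Sigma[symmetric]) (auto simp: case_prod_unfold)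
  also have "\<dots> \<le> (\<Sum>j<k. 1 / (4 * real k))" by (intro sum_mono summand) auto
  also have "\<dots> \<le> 1 / 4" by simp
  finally show ?thesis .
qed

text \<open>The sets \<open>T\<close> of \<open>m\<close> vertices in a block, each with \<open>3 * m\<close> possible edges inside it. The bound
\<open>m \<le> D ^ k\<close> is implied by \<open>m \<le> D ^ q\<close> and serves to make the index set of \<open>(q, u, m)\<close> a product.\<close>

definition dense_sets :: "((nat \<times> nat \<times> nat) \<times> 'a set \<times> ('a \<times> 'a) set) set" where
  "dense_sets = (SIGMA (q, u, m):{..<k} \<times> {3..<k} \<times> {1..D ^ k}.
     if m \<le> D ^ q then SIGMA T:{T. T \<subseteq> block q u \<and> card T = m}.
       {F. F \<subseteq> candidates \<inter> T \<times> T \<and> card F = 3 * m} else {})"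

lemma finite_block: "finite (block q u)"
  using finite_X by (simp add: block_def)

lemma finite_dense_sets: "finite dense_sets"
  unfolding dense_sets_def using finite_block candidates_finite
  by (auto intro!: finite_SigmaI)

text \<open>For given \<open>q\<close>, \<open>u\<close>, \<open>m\<close> there are at most \<open>(6 * D ^ (q + 2 * u + 1) / m) ^ m\<close> sets \<open>T\<close> and \<open>m ^ (3 * m)\<close>
sets \<open>F\<close> for each of them, and every \<open>F\<close> has probability at most \<open>(1 / D ^ (q + u)) ^ (3 * m)\<close>. As
\<open>m \<le> D ^ q\<close>, the product is at most the \<open>m\<close>-th power of \<open>6 * D ^ (3 * q + 2 * u + 1) / D ^ (3 * q + 3 * u)\<close>, and
\<open>u \<ge> 3\<close> makes this at most \<open>6 / D ^ 2\<close>. The factor \<open>1 / D ^ 2\<close> pays for the \<open>k ^ 2\<close> choices of \<open>q\<close>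
and \<open>u\<close>.\<close>

lemma prob_some_dense_set:
  "(\<Sum>((q, u, m), T, F)\<in>dense_sets. \<Prod>e\<in>F. prob e) \<le> 1 / 4"
proof -
  let ?Q = "{..<k} \<times> {3..<k} \<times> {1..D ^ k}"
  let ?R = "\<lambda>q u m. if m \<le> D ^ q then SIGMA T:{T. T \<subseteq> block q u \<and> card T = m}.
       {F. F \<subseteq> candidates \<inter> T \<times> T \<and> card F = 3 * m} else {}"
  define x where "x = 6 / real D ^ 2"
  have x: "0 \<le> x" "x \<le> 1 / 2" "x * real k * real k \<le> 1 / 8"
  proof -
    have "8 ^ 2 \<le> D ^ 2" "(8 * k) ^ 2 \<le> D ^ 2"
      by (rule power_mono[OF D_ge(1)], simp, rule power_mono[OF D_ge(2)], simp)
    then have D64: "real (8 ^ 2) \<le> real (D ^ 2)" "real ((8 * k) ^ 2) \<le> real (D ^ 2)"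
      unfolding of_nat_le_iff .
    define N where "N = real D ^ 2"
    have N: "64 \<le> N" "64 * (real k * real k) \<le> N"
      using D64 by (simp_all add: N_def power2_eq_square mult_ac)
    show "0 \<le> x" "x \<le> 1 / 2" "x * real k * real k \<le> 1 / 8"
      unfolding x_def N_def[symmetric] using N by (simp_all add: divide_le_eq)
  qed
  have inner: "(\<Sum>(T, F)\<in>?R q u m. \<Prod>e\<in>F. prob e) \<le> x ^ m"
    if q: "3 \<le> u" and m: "1 \<le> m" for q u m
  proof (cases "m \<le> D ^ q")
    case True
    define c where "c = (1 / real D ^ (q + u)) ^ (3 * m)"
    have F: "(\<Prod>e\<in>F. prob e) \<le> c" if "T \<subseteq> block q u" "F \<subseteq> candidates \<inter> T \<times> T" "card F = 3 * m" for T F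
    proof -
      have "prob e \<le> 1 / real D ^ (q + u)" if "e \<in> F" for e
      proof -
        have "q + u \<le> lev (fst e)" 
          using that \<open>F \<subseteq> _\<close> \<open>T \<subseteq> _\<close> by (cases e) (auto simp: block_def)
        then show ?thesis unfolding prob_def using D_ge
          by (intro divide_left_mono power_increasing) auto
      qed
      then have "(\<Prod>e\<in>F. prob e) \<le> (\<Prod>e\<in>F. 1 / real D ^ (q + u))"
        by (intro prod_mono) (auto simp: prob_bounds)
      then show ?thesis by (simp add: c_def that)
    qed
    have "(\<Sum>(T, F)\<in>?R q u m. \<Prod>e\<in>F. prob e) \<le> (\<Sum>(T, F)\<in>?R q u m. c)"
      using True by (intro sum_mono) (auto intro!: F)
    also have "\<dots> = real (card (?R q u m)) * c" by (simp add: case_prod_unfold)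
    also have "real (card (?R q u m)) \<le> (6 * real D ^ (q + 2 * u + 1) / real m) ^ m * real m ^ (3 * m)"
    proof -
      have "real (card {F. F \<subseteq> candidates \<inter> T \<times> T \<and> card F = 3 * m}) \<le> real m ^ (3 * m)"
        if "T \<subseteq> block q u" "card T = m" for T
      proof -
        have fT: "finite T" using that finite_block by (auto dest: finite_subset)
        have "card (candidates \<inter> T \<times> T) \<le> card (T \<times> T)" using fT by (intro card_mono) auto
        then have le: "card (candidates \<inter> T \<times> T) \<le> m * m" using that by (simp add: card_cartesian_product)
        have "real (card {F. F \<subseteq> candidates \<inter> T \<times> T \<and> card F = 3 * m})
            = real (card (candidates \<inter> T \<times> T) choose (3 * m))"
          using fT by (subst n_subsets) auto
        also have "\<dots> \<le> (3 * real (card (candidates \<inter> T \<times> T)) / real (3 * m)) ^ (3 * m)"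
          using m by (intro binomial_le_exp_bound) auto
        also have "\<dots> \<le> real m ^ (3 * m)"
        proof (intro power_mono)
          have "real (card (candidates \<inter> T \<times> T)) \<le> real m * real m"
            using le by (simp flip: of_nat_mult)
          then show "3 * real (card (candidates \<inter> T \<times> T)) / real (3 * m) \<le> real m"
            using m by (simp add: field_simps)
        qed auto
        finally show ?thesis .
      qed
      then have "(\<Sum>T | T \<subseteq> block q u \<and> card T = m.
          real (card {F. F \<subseteq> candidates \<inter> T \<times> T \<and> card F = 3 * m}))
          \<le> (\<Sum>T | T \<subseteq> block q u \<and> card T = m. real m ^ (3 * m))"
        by (intro sum_mono) auto
      also have "\<dots> = real (card (block q u) choose m) * real m ^ (3 * m)"
        using finite_block by (simp add: n_subsets)
      also have "\<dots> \<le> (6 * real D ^ (q + 2 * u + 1) / real m) ^ m * real m ^ (3 * m)"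
      proof (intro mult_right_mono)
        have "card (block q u) \<le> card {v \<in> X. lev v < k \<and> lev v \<le> q + 2 * u}"
          using finite_X by (intro card_mono) (auto simp: block_def)
        also have "\<dots> \<le> 2 * D ^ (q + 2 * u + 1)" using card_levels_below[of "q + 2 * u"] by simp
        finally have "card (block q u) \<le> 2 * D ^ (q + 2 * u + 1)" .
        from of_nat_mono[OF this, where 'a = real]
        have "real (card (block q u)) \<le> 2 * real D ^ (q + 2 * u + 1)"
          by (simp only: of_nat_mult of_nat_power of_nat_numeral)
        then have "(3 * real (card (block q u)) / real m) ^ m \<le> (6 * real D ^ (q + 2 * u + 1) / real m) ^ m"
          by (intro power_mono divide_right_mono) auto
        then show "real (card (block q u) choose m) \<le> (6 * real D ^ (q + 2 * u + 1) / real m) ^ m"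
          using binomial_le_exp_bound[of m "card (block q u)"] m by linarith
      qed auto
      finally show ?thesis using True finite_block candidates_finite
        by (simp add: card_SigmaI)
    qed
    also have "(6 * real D ^ (q + 2 * u + 1) / real m) ^ m * real m ^ (3 * m) * c
        = (6 * real D ^ (q + 2 * u + 1) * real m ^ 2 / real D ^ (3 * (q + u))) ^ m"
    proof -
      have "6 * real D ^ (q + 2 * u + 1) * real m ^ 2 / real D ^ (3 * (q + u))
        = 6 * real D ^ (q + 2 * u + 1) / real m * real m ^ 3 * (1 / real D ^ (q + u)) ^ 3"
      proof -
        have pw: "real D ^ (3 * (q + u)) = (real D ^ (q + u)) ^ 3"
          by (metis power_mult mult.commute)
        show ?thesis unfolding pw using m by (simp add: power2_eq_square power3_eq_cube)
      qed
      moreover have "a ^ m * b ^ (3 * m) * c' ^ (3 * m) = (a * b ^ 3 * c' ^ 3) ^ m" for a b c' :: real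
        by (simp add: power_mult power_mult_distrib)
      ultimately show ?thesis by (simp only: c_def)
    qed
    also have "\<dots> \<le> x ^ m"
    proof (intro power_mono)
      have "real m ^ 2 \<le> (real D ^ q) ^ 2"
        using True by (intro power_mono) (auto simp flip: of_nat_power)
      then have "6 * real D ^ (q + 2 * u + 1) * real m ^ 2 * real D ^ 2
          \<le> 6 * real D ^ (q + 2 * u + 1) * (real D ^ q) ^ 2 * real D ^ 2"
        by (intro mult_left_mono mult_right_mono) auto
      also have "\<dots> = 6 * real D ^ (q + 2 * u + 1 + 2 * q + 2)"
        by (simp add: power_add power_mult mult_ac power_mult_distrib power2_eq_square power3_eq_cube)
      also have "\<dots> \<le> 6 * real D ^ (3 * (q + u))"
        using q D_ge by (intro mult_left_mono power_increasing) auto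
      finally show "6 * real D ^ (q + 2 * u + 1) * real m ^ 2 / real D ^ (3 * (q + u)) \<le> x"
        using D_ge unfolding x_def by (simp add: divide_simps mult_ac)
    qed auto
    finally show ?thesis by (simp add: c_def mult_right_mono)
  qed (use x in auto)
  have "(\<Sum>((q, u, m), T, F)\<in>dense_sets. \<Prod>e\<in>F. prob e)
      = (\<Sum>(q, u, m)\<in>?Q. \<Sum>(T, F)\<in>?R q u m. \<Prod>e\<in>F. prob e)"
    unfolding dense_sets_def using finite_block candidates_finite
    by (subst sum.Sigma[symmetric]) (auto simp: case_prod_unfold intro!: finite_SigmaI)
  also have "\<dots> \<le> (\<Sum>(q, u, m)\<in>?Q. x ^ m)"
    by (intro sum_mono) (auto intro!: inner)
  also have "\<dots> = real k * (real (k - 3) * (\<Sum>m=1..D ^ k. x ^ m))"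
    by (simp flip: sum.cartesian_product)
  also have "\<dots> \<le> real k * (real k * (2 * x))"
    using geometric_sum_le_twice_first[OF x(1,2)] x(1)
    by (intro mult_left_mono mult_mono sum_nonneg) auto
  also have "\<dots> \<le> 1 / 4" using x(3) by (simp add: algebra_simps)
  finally show ?thesis .
qed

lemma exists_good_edges:
  "\<exists>E\<subseteq>candidates.
     (\<forall>j<k. \<forall>S B. S \<subseteq> {v \<in> X. lev v < j} \<longrightarrow> B \<subseteq> level j \<longrightarrow> D ^ Suc j \<le> k * card B \<longrightarrow>
        1 \<le> weight S \<longrightarrow> (S \<times> B) \<inter> E \<noteq> {}) \<and>
     (\<forall>q u T. 3 \<le> u \<longrightarrow> T \<subseteq> block q u \<longrightarrow> T \<noteq> {} \<longrightarrow> card T \<le> D ^ q \<longrightarrow>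
        card (E \<inter> T \<times> T) < 3 * card T)"
proof -
  let ?A = "\<lambda>(j, S, B). S \<times> B" and ?F = "\<lambda>(t, T, F). F"
  have "\<exists>E\<subseteq>candidates. (\<forall>i\<in>heavy_pairs. ?A i \<inter> E \<noteq> {}) \<and> (\<forall>j\<in>dense_sets. \<not> ?F j \<subseteq> E)"
  proof (rule exists_subset_hitting_and_not_containing[of _ prob])
    show "?A i \<subseteq> candidates" if "i \<in> heavy_pairs" for i
      using that by (auto simp: heavy_pairs_def candidates_def level_def)
    show "?F j \<subseteq> candidates" if "j \<in> dense_sets" for j
      using that by (fastforce simp: dense_sets_def split: if_splits)
    show "(\<Sum>i\<in>heavy_pairs. \<Prod>e\<in>?A i. 1 - prob e) + (\<Sum>j\<in>dense_sets. \<Prod>e\<in>?F j. prob e) < 1"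
      using prob_some_heavy_pair_empty prob_some_dense_set by (simp add: case_prod_unfold)
  qed (use candidates_finite prob_bounds finite_heavy_pairs finite_dense_sets in auto)
  then obtain E where E: "E \<subseteq> candidates"
    and hit: "\<forall>i\<in>heavy_pairs. ?A i \<inter> E \<noteq> {}"
    and sparse: "\<forall>j\<in>dense_sets. \<not> ?F j \<subseteq> E" by (elim exE conjE)
  have "card (E \<inter> T \<times> T) < 3 * card T"
    if u: "3 \<le> u" and T: "T \<subseteq> block q u" "T \<noteq> {}" "card T \<le> D ^ q" for q u T
  proof (rule ccontr)
    assume "\<not> ?thesis"
    then obtain F where F: "F \<subseteq> E \<inter> T \<times> T" "card F = 3 * card T"
      by (metis linorder_not_less obtain_subset_with_card_n)
    obtain v where v: "v \<in> block q u" using T by auto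
    have qu: "q < k" "u < k" using v u by (auto simp: block_def)
    have "0 < card T" using T finite_block by (auto simp: card_gt_0_iff dest: finite_subset)
    moreover have "D ^ q \<le> D ^ k" using D_ge qu by (intro power_increasing) auto
    ultimately have "((q, u, card T), T, F) \<in> dense_sets"
      unfolding dense_sets_def using qu u T F E by auto
    then show False using bspec[OF sparse] F by force
  qed
  note sparse_E = this
  have hit_E: "(S \<times> B) \<inter> E \<noteq> {}" if "j < k" "S \<subseteq> {v \<in> X. lev v < j}" "B \<subseteq> level j"
    "D ^ Suc j \<le> k * card B" "1 \<le> weight S" for j S B
    using bspec[OF hit, of "(j, S, B)"] that by (auto simp: heavy_pairs_def)
  show ?thesis
    by (intro exI[of _ E] conjI allI impI E) (rule hit_E sparse_E, assumption+)+
qed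

lemma independent_weight_le:
  assumes hit: "\<And>j S B. j < k \<Longrightarrow> S \<subseteq> {v \<in> X. lev v < j} \<Longrightarrow> B \<subseteq> level j \<Longrightarrow>
      D ^ Suc j \<le> k * card B \<Longrightarrow> 1 \<le> weight S \<Longrightarrow> (S \<times> B) \<inter> E \<noteq> {}"
    and I: "I \<subseteq> X" "\<And>u v. u \<in> I \<Longrightarrow> v \<in> I \<Longrightarrow> (u, v) \<notin> E"
  shows "weight {v \<in> I. lev v < k} \<le> 3"
proof (rule ccontr)
  assume neg: "\<not> ?thesis"
  have fI: "finite I" using I finite_X by (auto dest: finite_subset)
  define w where "w i = weight (I \<inter> level i)" for i
  have w: "w i = real (card (I \<inter> level i)) / real D ^ Suc i" for i
  proof -
    have "w i = (\<Sum>v\<in>I \<inter> level i. 1 / real D ^ Suc i)"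
      unfolding w_def weight_def by (intro sum.cong) (auto simp: level_def)
    then show ?thesis by simp
  qed
  have w_nonneg: "0 \<le> w i" for i by (simp add: w)
  have w_le_1: "w i \<le> 1" if "i < k" for i
  proof -
    have "card (I \<inter> level i) \<le> D ^ Suc i"
      using card_mono[of "level i" "I \<inter> level i"] card_level[OF that, folded level_def] by simp
    then have "real (card (I \<inter> level i)) \<le> real D ^ Suc i"
      by (metis of_nat_le_iff of_nat_power)
    then show ?thesis unfolding w using D_ge by (simp add: divide_le_eq_1)
  qed
  have weight_split: "weight {v \<in> I. lev v < j} = (\<Sum>i<j. w i)" for j
  proof -
    have "{v \<in> I. lev v < j} = (\<Union>i<j. I \<inter> level i)" using I by (auto simp: level_def)
    then show ?thesis unfolding weight_def w_def
      by (simp only:) (subst sum.UNION_disjoint, auto simp: level_def finite_X)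
  qed
  (* The levels outside J carry total weight at most 1, the level j = Max J at most 1. *)
  define J where "J = {j. j < k \<and> D ^ Suc j \<le> k * card (I \<inter> level j)}"
  have J: "J \<subseteq> {..<k}" "finite J" by (auto simp: J_def)
  have "(\<Sum>i\<in>{..<k} - J. w i) \<le> (\<Sum>i\<in>{..<k} - J. 1 / real k)"
  proof (intro sum_mono)
    fix i assume "i \<in> {..<k} - J"
    then have "k * card (I \<inter> level i) < D ^ Suc i" "0 < k" by (auto simp: J_def)
    then have "real k * real (card (I \<inter> level i)) \<le> real D ^ Suc i"
      by (metis less_imp_le of_nat_le_iff of_nat_mult of_nat_power)
    then show "w i \<le> 1 / real k" unfolding w using D_ge \<open>0 < k\<close>
      by (simp add: divide_le_eq le_divide_eq mult.commute)
  qed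
  also have "\<dots> \<le> (\<Sum>i<k. 1 / real k)" by (intro sum_mono2) auto
  also have "\<dots> \<le> 1" by simp
  finally have "2 < (\<Sum>i\<in>J. w i)"
    using neg weight_split[of k] sum.subset_diff[OF J(1), of w] by simp
  moreover from this have "J \<noteq> {}" by auto
  define j where "j = Max J"
  have j: "j \<in> J" "\<And>i. i \<in> J \<Longrightarrow> i \<le> j" using J \<open>J \<noteq> {}\<close> by (auto simp: j_def)
  ultimately have "1 < (\<Sum>i\<in>J - {j}. w i)"
    using w_le_1[of j] J sum.remove[OF J(2) j(1), of w] by (auto simp: J_def)
  also have "\<dots> \<le> (\<Sum>i<j. w i)"
    using j by (intro sum_mono2) (auto simp: w_nonneg order.strict_iff_order)
  finally have "1 \<le> weight {v \<in> I. lev v < j}" by (simp add: weight_split)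
  then have "({v \<in> I. lev v < j} \<times> (I \<inter> level j)) \<inter> E \<noteq> {}"
    using j I by (intro hit[of j]) (auto simp: J_def)
  then show False using I by auto
qed

lemma weight_X: "weight {v \<in> X. lev v < k} = real k"
proof -
  have "{v \<in> X. lev v < k} = (\<Union>i<k. level i)" by (auto simp: level_def)
  then have "weight {v \<in> X. lev v < k} = (\<Sum>i<k. \<Sum>v\<in>level i. 1 / real D ^ Suc (lev v))"
    unfolding weight_def by (simp only:) (subst sum.UNION_disjoint, auto simp: level_def finite_X)
  also have "\<dots> = (\<Sum>i<k. \<Sum>v\<in>level i. 1 / real D ^ Suc i)"
    by (intro sum.cong) (auto simp: level_def)
  also have "\<dots> = (\<Sum>i<k. 1)"
    using D_ge card_level by (intro sum.cong) (auto simp: level_def simp del: power_Suc)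
  finally show ?thesis by simp
qed

text \<open>\<open>M\<close> stands for the independence number of the subgraph induced by \<open>H\<close>. The set \<open>H\<close> is covered by the isolated
vertices, the low levels that together hold at most a quarter of it, at most five levels around
\<open>q\<close>, and at most \<open>L\<close> blocks. Of each of these parts except the low levels, at least a sixth is independent.\<close>

lemma large_independent_subset:
  assumes E: "E \<subseteq> candidates"
    and sparse: "\<And>q u T. 3 \<le> u \<Longrightarrow> T \<subseteq> block q u \<Longrightarrow> T \<noteq> {} \<Longrightarrow> card T \<le> D ^ q \<Longrightarrow>
        card (E \<inter> T \<times> T) < 3 * card T"
    and H: "H \<subseteq> X"
    and M: "\<And>I. I \<subseteq> H \<Longrightarrow> (\<forall>u\<in>I. \<forall>v\<in>I. (u, v) \<notin> E) \<Longrightarrow> card I \<le> M"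
    and k: "k < 2 ^ L"
  shows "card H \<le> 8 * (L + 1) * M"
proof -
  have fH: "finite H" using H finite_X by (auto dest: finite_subset)
  have block_le: "card (H \<inter> block q u) \<le> 6 * M" if u: "3 \<le> u" and q: "card H \<le> D ^ q" for q u
  proof -
    let ?arcs = "E \<union> E\<inverse>"
    have "card (?arcs \<inter> T \<times> T) < 6 * card T" if T: "T \<subseteq> H \<inter> block q u" "T \<noteq> {}" for T
    proof -
      have "?arcs \<inter> T \<times> T = (E \<inter> T \<times> T) \<union> (E \<inter> T \<times> T)\<inverse>" by auto
      then have "card (?arcs \<inter> T \<times> T) \<le> 2 * card (E \<inter> T \<times> T)"
        using card_Un_le[of "E \<inter> T \<times> T" "(E \<inter> T \<times> T)\<inverse>"] by simp
      moreover have "card T \<le> D ^ q" using T fH q card_mono[of H T] by auto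
      ultimately show ?thesis using sparse[OF u, of T q] T by auto
    qed
    then have "\<exists>I\<subseteq>H \<inter> block q u. (\<forall>u\<in>I. \<forall>v\<in>I. (u, v) \<notin> ?arcs) \<and> card (H \<inter> block q u) \<le> 6 * card I"
      using fH E by (intro independent_subset_of_hereditarily_sparse) (auto intro!: symI simp: irrefl_def candidates_def)
    then show ?thesis using M by (metis (no_types, lifting) Int_subset_iff UnI1 le_trans mult_le_mono2)
  qed
  have level_le: "card (H \<inter> level i) \<le> M" for i
    using E by (intro M) (auto simp: level_def candidates_def)
  define isolated where "isolated = {v \<in> H. k \<le> lev v}"
  have isolated_le: "card isolated \<le> M"
    unfolding isolated_def using E by (intro M) (auto simp: candidates_def)
  define q where "q = (LEAST q. card H \<le> D ^ q)"
  have "card H \<le> D ^ card H"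
    using less_exp[of "card H"] power_mono[of 2 D "card H"] D_ge by linarith
  then have q: "card H \<le> D ^ q" unfolding q_def by (rule LeastI)
  define low where "low = {v \<in> X. lev v < k \<and> lev v + 3 \<le> q}"
  have low_le: "4 * card low \<le> card H"
  proof (cases "3 \<le> q")
    case True
    then obtain p where p: "q = Suc (Suc (Suc p))"
      by (metis One_nat_def Suc_le_D eval_nat_numeral(3) numeral_2_eq_2 Suc_le_mono)
    have "\<not> card H \<le> D ^ Suc (Suc p)" unfolding q_def using p q_def by (intro not_less_Least) simp
    moreover have "8 * D ^ Suc p \<le> D * D ^ Suc p" using D_ge by (intro mult_right_mono) auto
    moreover have "card low \<le> 2 * D ^ Suc p" using card_levels_below[of p] by (simp add: low_def p)
    ultimately show ?thesis unfolding power_Suc[of D "Suc p"] by linarith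
  qed (auto simp: low_def)
  have cover: "H \<subseteq> isolated \<union> low \<union> (\<Union>i\<in>{q - 2..q + 2}. H \<inter> level i) \<union>
      (\<Union>l\<in>{2..<L}. H \<inter> block q (2 ^ l - 1))"
  proof
    fix v assume v: "v \<in> H"
    consider "k \<le> lev v" | "lev v < k" "lev v + 3 \<le> q" | "lev v < k" "lev v \<in> {q - 2..q + 2}"
      | "lev v < k" "q + 3 \<le> lev v" by fastforce
    then show "v \<in> isolated \<union> low \<union> (\<Union>i\<in>{q - 2..q + 2}. H \<inter> level i) \<union>
      (\<Union>l\<in>{2..<L}. H \<inter> block q (2 ^ l - 1))"
    proof cases
      case 4
      define t where "t = lev v - q + 1"
      obtain l where l: "2 ^ l \<le> t" "t < 2 * 2 ^ l"
        using ex_power_ivl1[of 2 t] by (auto simp: t_def)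
      have "t \<le> k" using 4 by (simp add: t_def)
      then have "(2::nat) ^ l < 2 ^ L" using l(1) k by (meson le_less_trans)
      then have "l < L" by simp
      moreover have "2 \<le> l"
      proof (rule ccontr)
        assume "\<not> 2 \<le> l"
        then have "(2::nat) ^ l \<le> 2 ^ 1" by (intro power_increasing) auto
        then show False using l(2) 4 by (simp add: t_def)
      qed
      moreover have "v \<in> block q (2 ^ l - 1)" using l 4 v H by (auto simp: block_def t_def)
      ultimately show ?thesis using v by auto
    qed (use v H in \<open>auto simp: isolated_def low_def level_def\<close>)
  qed
  have "card H \<le> card (isolated \<union> low \<union> (\<Union>i\<in>{q - 2..q + 2}. H \<inter> level i) \<union>
      (\<Union>l\<in>{2..<L}. H \<inter> block q (2 ^ l - 1)))"
    using fH finite_X by (intro card_mono[OF _ cover]) (auto simp: isolated_def low_def)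
  also have "\<dots> \<le> card isolated + card low + card (\<Union>i\<in>{q - 2..q + 2}. H \<inter> level i) +
      card (\<Union>l\<in>{2..<L}. H \<inter> block q (2 ^ l - 1))"
    by (meson add_mono card_Un_le le_refl order_trans)
  also have "card (\<Union>i\<in>{q - 2..q + 2}. H \<inter> level i) \<le> (\<Sum>i\<in>{q - 2..q + 2}. M)"
    by (intro order.trans[OF card_UN_le] sum_mono level_le) auto
  also have "\<dots> \<le> 5 * M"
  proof -
    have "Suc (q + 2) - (q - 2) \<le> 5" by arith
    from mult_le_mono1[OF this, of M] show ?thesis by simp
  qed
  also have "card (\<Union>l\<in>{2..<L}. H \<inter> block q (2 ^ l - 1)) \<le> (\<Sum>l\<in>{2..<L}. 6 * M)"
  proof (intro order.trans[OF card_UN_le] sum_mono block_le q)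
    fix l assume "l \<in> {2..<L}"
    then have "(2::nat) ^ 2 \<le> 2 ^ l" by (intro power_increasing) auto
    then show "3 \<le> 2 ^ l - (1::nat)" by simp
  qed auto
  also have "\<dots> \<le> 6 * L * M" by simp
  finally have "card H \<le> card low + 6 * M + 6 * L * M" using isolated_le by simp
  then show ?thesis using low_le by (simp add: algebra_simps)
qed

end

section \<open>Independence number, Hall ratio and fractional chromatic number\<close>

lemma simple_graphI:
  assumes "finite X" "X \<noteq> {}" "R \<subseteq> X \<times> X" "sym R" "irrefl R"
  shows "finite_simple_graph \<lparr>pverts = X, parcs = R\<rparr>"
proof -
  have "finite R" using assms by (auto intro: finite_subset)
  then have "pair_graph \<lparr>pverts = X, parcs = R\<rparr>"
    using assms by unfold_locales (auto simp: symmetric_def irrefl_def)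
  then show ?thesis using assms by (simp add: finite_simple_graph_def)
qed

lemma simple_graphD:
  assumes "finite_simple_graph G"
  shows "finite (pverts G)" "pverts G \<noteq> {}" "parcs G \<subseteq> pverts G \<times> pverts G" "sym (parcs G)"
    "irrefl (parcs G)" "pair_wf_digraph G"
proof -
  interpret pair_graph G using assms by (simp add: finite_simple_graph_def)
  show "finite (pverts G)" "pverts G \<noteq> {}" "parcs G \<subseteq> pverts G \<times> pverts G" "sym (parcs G)"
    "irrefl (parcs G)" "pair_wf_digraph G"
    using assms pair_finite_verts arc_fst_in_verts arc_snd_in_verts no_loops' arcs_symmetric
      pair_wf_digraph_axioms
    by (force simp: finite_simple_graph_def sym_def irrefl_def)+
qed

lemma subgraph_iff:
  assumes "finite_simple_graph H" "finite_simple_graph G"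
  shows "subgraph (with_proj H) (with_proj G) \<longleftrightarrow> pverts H \<subseteq> pverts G \<and> parcs H \<subseteq> parcs G"
  using assms[THEN simple_graphD(6)]
  by (simp add: subgraph_def compatible_def wf_digraph_wp_iff)

lemma finite_independent_sets:
  assumes "finite (pverts G)" shows "finite (independent_sets G)"
  by (rule finite_subset[of _ "Pow (pverts G)"]) (use assms in \<open>auto simp: independent_sets_def\<close>)

lemma card_le_independence_number:
  assumes "finite (pverts G)" "I \<in> independent_sets G"
  shows "card I \<le> independence_number G"
  unfolding independence_number_def using assms finite_independent_sets by (intro Max_ge) auto

lemma empty_independent: "{} \<in> independent_sets G"
  by (simp add: independent_sets_def)

lemma independence_number_attained:
  assumes "finite (pverts G)"
  obtains I where "I \<in> independent_sets G" "card I = independence_number G"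
proof -
  have "independence_number G \<in> card ` independent_sets G"
    unfolding independence_number_def using assms finite_independent_sets empty_independent
    by (intro Max_in) auto
  then show ?thesis using that by auto
qed

lemma independence_number_bounds:
  assumes "finite_simple_graph G"
  shows "1 \<le> independence_number G" "independence_number G \<le> card (pverts G)"
proof -
  obtain v where "v \<in> pverts G" using simple_graphD[OF assms] by auto
  then have "{v} \<in> independent_sets G"
    using simple_graphD[OF assms] by (auto simp: independent_sets_def irrefl_def)
  then show "1 \<le> independence_number G"
    using card_le_independence_number simple_graphD[OF assms] by fastforce
  obtain I where "I \<in> independent_sets G" "card I = independence_number G"
    using independence_number_attained simple_graphD[OF assms] by blast
  then show "independence_number G \<le> card (pverts G)"
    using simple_graphD[OF assms] by (metis (no_types, lifting) card_mono independent_sets_def mem_Collect_eq)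
qed

lemma hall_ratio_set_finite:
  assumes "finite_simple_graph G"
  shows "finite {real (card (pverts H)) / real (independence_number H) | H.
            finite_simple_graph H \<and> subgraph (with_proj H) (with_proj G)}"
proof (rule finite_subset)
  let ?n = "card (pverts G)"
  show "finite ((\<lambda>(a, b). real a / real b) ` ({..?n} \<times> {..?n}))" by simp
  show "{real (card (pverts H)) / real (independence_number H) | H.
            finite_simple_graph H \<and> subgraph (with_proj H) (with_proj G)}
      \<subseteq> (\<lambda>(a, b). real a / real b) ` ({..?n} \<times> {..?n})"
  proof
    fix x assume "x \<in> {real (card (pverts H)) / real (independence_number H) | H.
            finite_simple_graph H \<and> subgraph (with_proj H) (with_proj G)}"
    then obtain H where H: "x = real (card (pverts H)) / real (independence_number H)"
      "finite_simple_graph H" "pverts H \<subseteq> pverts G"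
      using subgraph_iff assms by auto
    have "card (pverts H) \<le> ?n" using H simple_graphD[OF assms] by (intro card_mono) auto
    then show "x \<in> (\<lambda>(a, b). real a / real b) ` ({..?n} \<times> {..?n})"
      using independence_number_bounds[OF H(2)] H(1)
      by (intro image_eqI[of _ _ "(card (pverts H), independence_number H)"]) auto
  qed
qed

lemma hall_ratio_le:
  assumes G: "finite_simple_graph G"
    and le: "\<And>H. finite_simple_graph H \<Longrightarrow> pverts H \<subseteq> pverts G \<Longrightarrow> parcs H \<subseteq> parcs G \<Longrightarrow>
      real (card (pverts H)) \<le> r * real (independence_number H)"
  shows "hall_ratio G \<le> r"
proof -
  let ?S = "{real (card (pverts H)) / real (independence_number H) | H.
            finite_simple_graph H \<and> subgraph (with_proj H) (with_proj G)}"
  have bound: "x \<le> r" if x: "x \<in> ?S" for x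
  proof -
    from x obtain H where H: "x = real (card (pverts H)) / real (independence_number H)"
      "finite_simple_graph H" "pverts H \<subseteq> pverts G" "parcs H \<subseteq> parcs G"
      using subgraph_iff assms by auto
    then show ?thesis using le[of H] independence_number_bounds[OF H(2)]
      by (simp add: divide_le_eq)
  qed
  have "subgraph (with_proj G) (with_proj G)" using subgraph_iff[OF G G] by simp
  then have "?S \<noteq> {}" using G by (auto simp del: with_proj_simps)
  then show ?thesis unfolding hall_ratio_def
    by (rule Max.boundedI[OF hall_ratio_set_finite[OF G]]) (rule bound)
qed

lemma hall_ratio_ge:
  assumes G: "finite_simple_graph G" and H: "finite_simple_graph H" "pverts H \<subseteq> pverts G" "parcs H \<subseteq> parcs G"
  shows "real (card (pverts H)) / real (independence_number H) \<le> hall_ratio G"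
proof -
  have "subgraph (with_proj H) (with_proj G)" using H subgraph_iff[OF H(1) G] by simp
  then have "real (card (pverts H)) / real (independence_number H) \<in>
      {real (card (pverts H)) / real (independence_number H) | H.
            finite_simple_graph H \<and> subgraph (with_proj H) (with_proj G)}"
    unfolding mem_Collect_eq using H(1) by (intro exI[of _ H] conjI refl)
  then show ?thesis unfolding hall_ratio_def by (rule Max_ge[OF hall_ratio_set_finite[OF G]])
qed

lemma hall_ratio_ge_1:
  assumes "finite_simple_graph G" shows "1 \<le> hall_ratio G"
proof -
  have "1 \<le> real (card (pverts G)) / real (independence_number G)"
    using independence_number_bounds[OF assms] by (simp add: le_divide_eq)
  then show ?thesis using hall_ratio_ge[OF assms assms] by simp
qed

text \<open>The form in which the Hall ratio is used for upper bounds: it is applied to induced subgraphs.\<close>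

lemma independent_subset_hall_ratio:
  assumes G: "finite_simple_graph G" and U: "U \<subseteq> pverts G" "U \<noteq> {}"
  shows "\<exists>I\<in>independent_sets G. I \<subseteq> U \<and> real (card U) \<le> hall_ratio G * real (card I)"
proof -
  let ?H = "\<lparr>pverts = U, parcs = parcs G \<inter> U \<times> U\<rparr>"
  have H: "finite_simple_graph ?H"
    using simple_graphD[OF G] U by (intro simple_graphI) (auto simp: sym_def irrefl_def dest: finite_subset)
  obtain I where I: "I \<in> independent_sets ?H" "card I = independence_number ?H"
    using independence_number_attained[of ?H] simple_graphD[OF H] by auto
  have "real (card U) \<le> hall_ratio G * real (card I)"
    using hall_ratio_ge[OF G H] U(1) independence_number_bounds(1)[OF H]
    by (simp add: divide_le_eq I(2))
  moreover have "I \<in> independent_sets G" "I \<subseteq> U"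
    using I(1) U(1) by (fastforce simp: independent_sets_def)+
  ultimately show ?thesis by blast
qed

lemma fractional_chromatic_number_bdd_below:
  "bdd_below {\<Sum>I\<in>independent_sets G. x I | x. fractional_colouring G x}"
  by (rule bdd_belowI[of _ 0]) (auto simp: fractional_colouring_def intro: sum_nonneg)

lemma family_colouring:
  assumes G: "finite_simple_graph G" and F: "\<F> \<subseteq> independent_sets G" "pverts G \<subseteq> \<Union>\<F>"
  shows "fractional_colouring G (\<lambda>I. if I \<in> \<F> then 1 else 0)"
    "(\<Sum>I\<in>independent_sets G. if I \<in> \<F> then 1 else (0::real)) = real (card \<F>)"
proof -
  have fin: "finite (independent_sets G)" using simple_graphD[OF G] finite_independent_sets by auto
  have "1 \<le> (\<Sum>I | I \<in> independent_sets G \<and> v \<in> I. if I \<in> \<F> then 1 else (0::real))"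
    if v: "v \<in> pverts G" for v
  proof -
    obtain J where J: "J \<in> \<F>" "v \<in> J" using F v by auto
    have "(\<Sum>I\<in>{J}. if I \<in> \<F> then 1 else (0::real))
        \<le> (\<Sum>I | I \<in> independent_sets G \<and> v \<in> I. if I \<in> \<F> then 1 else 0)"
      using fin J F by (intro sum_mono2) auto
    then show ?thesis using J by simp
  qed
  then show "fractional_colouring G (\<lambda>I. if I \<in> \<F> then 1 else 0)"
    by (auto simp: fractional_colouring_def)
  show "(\<Sum>I\<in>independent_sets G. if I \<in> \<F> then 1 else (0::real)) = real (card \<F>)"
    using fin F by (simp add: sum.If_cases Int_absorb1)
qed

lemma fractional_chromatic_number_le_card:
  assumes G: "finite_simple_graph G" and F: "\<F> \<subseteq> independent_sets G" "pverts G \<subseteq> \<Union>\<F>"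
  shows "fractional_chromatic_number G \<le> real (card \<F>)"
  unfolding fractional_chromatic_number_def
  using fractional_chromatic_number_bdd_below[of G] family_colouring[OF assms]
  by (intro cInf_lower) (auto intro!: exI[of _ "\<lambda>I. if I \<in> \<F> then 1 else 0"])

text \<open>A set \<open>I\<close> with \<open>card U \<le> \<rho> * card I\<close> is removed, where \<open>\<rho>\<close> is the Hall ratio. It costs 1, and
\<open>ln (card U)\<close> drops by at least \<open>card I / card U \<ge> 1 / \<rho>\<close>, so \<open>\<rho> * ln (card U)\<close> drops by at least 1.\<close>

lemma greedy_cover:
  assumes G: "finite_simple_graph G" and U: "U \<subseteq> pverts G" "U \<noteq> {}"
  shows "\<exists>\<F>\<subseteq>independent_sets G. U \<subseteq> \<Union>\<F> \<and> real (card \<F>) \<le> hall_ratio G * (1 + ln (real (card U)))"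
  using U
proof (induction "card U" arbitrary: U rule: less_induct)
  case less
  have fU: "finite U" using less.prems simple_graphD[OF G] by (auto dest: finite_subset)
  obtain I where I: "I \<in> independent_sets G" "I \<subseteq> U" "real (card U) \<le> hall_ratio G * real (card I)"
    using independent_subset_hall_ratio[OF G less.prems] by blast
  have cU: "0 < card U" using less.prems fU by (simp add: card_gt_0_iff)
  have fI: "finite I" using I fU by (auto dest: finite_subset)
  have \<rho>: "1 \<le> hall_ratio G" by (rule hall_ratio_ge_1[OF G])
  have cI: "0 < card I" using I(3) cU by (cases "card I") auto
  show ?case
  proof (cases "U - I = {}")
    case True
    have "1 \<le> hall_ratio G * (1 + ln (real (card U)))"
      using \<rho> cU mult_mono[of 1 "hall_ratio G" 1 "1 + ln (real (card U))"] by simp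
    then show ?thesis using True I by (intro exI[of _ "{I}"]) auto
  next
    case False
    have card_diff: "card (U - I) = card U - card I" using I fI by (simp add: card_Diff_subset)
    have pos: "0 < card (U - I)" using False fU by (simp add: card_gt_0_iff)
    obtain \<F> where F: "\<F> \<subseteq> independent_sets G" "U - I \<subseteq> \<Union>\<F>"
      "real (card \<F>) \<le> hall_ratio G * (1 + ln (real (card (U - I))))"
      using less.hyps[of "U - I"] card_diff cI cU False less.prems by auto
    have fF: "finite \<F>" using F finite_independent_sets simple_graphD[OF G] by (auto dest: finite_subset)
    have "ln (real (card (U - I))) - ln (real (card U)) = ln (real (card (U - I)) / real (card U))"
      using pos cU by (simp add: ln_div)
    also have "\<dots> \<le> real (card (U - I)) / real (card U) - 1"
      using pos cU by (intro ln_le_minus_one) simp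
    also have "\<dots> = - (real (card I) / real (card U))"
      using card_diff pos cU by (simp add: field_simps)
    finally have step: "ln (real (card (U - I))) + real (card I) / real (card U) \<le> ln (real (card U))"
      by simp
    have "real (card (insert I \<F>)) \<le> 1 + real (card \<F>)"
      using fF by (simp add: card_insert_if)
    also have "\<dots> \<le> hall_ratio G * (real (card I) / real (card U)) + hall_ratio G * (1 + ln (real (card (U - I))))"
      using I(3) cU F(3) by (intro add_mono) (simp_all add: field_simps)
    also have "\<dots> = hall_ratio G * (1 + (ln (real (card (U - I))) + real (card I) / real (card U)))"
      by (simp add: algebra_simps)
    also have "\<dots> \<le> hall_ratio G * (1 + ln (real (card U)))"
      using \<rho> step by (intro mult_left_mono) auto
    finally show ?thesis using F I by (intro exI[of _ "insert I \<F>"]) auto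
  qed
qed

lemma fractional_chromatic_number_le_hall_ratio:
  assumes "finite_simple_graph G"
  shows "fractional_chromatic_number G \<le> hall_ratio G * (1 + ln (real (card (pverts G))))"
  using greedy_cover[OF assms, of "pverts G"] fractional_chromatic_number_le_card[OF assms]
    simple_graphD[OF assms] by (meson order_refl order_trans)

text \<open>Weak linear programming duality: count the pairs of a vertex and an independent set that contains it, with
weight \<open>w v * x I\<close>, in two ways.\<close>

lemma fractional_chromatic_number_ge_weight:
  assumes G: "finite_simple_graph G" and w: "\<And>v. v \<in> pverts G \<Longrightarrow> 0 \<le> w v"
    and a: "0 < a" "\<And>I. I \<in> independent_sets G \<Longrightarrow> (\<Sum>v\<in>I. w v) \<le> a"
  shows "(\<Sum>v\<in>pverts G. w v) / a \<le> fractional_chromatic_number G"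
  unfolding fractional_chromatic_number_def
proof (rule cInf_greatest)
  have "pverts G \<subseteq> \<Union>((\<lambda>v. {v}) ` pverts G)" "(\<lambda>v. {v}) ` pverts G \<subseteq> independent_sets G"
    using simple_graphD[OF G] by (auto simp: independent_sets_def irrefl_def)
  from family_colouring(1)[OF G this(2,1)]
  show "{\<Sum>I\<in>independent_sets G. x I | x. fractional_colouring G x} \<noteq> {}" by blast
next
  fix c assume "c \<in> {\<Sum>I\<in>independent_sets G. x I | x. fractional_colouring G x}"
  then obtain x where x: "fractional_colouring G x" and c: "c = (\<Sum>I\<in>independent_sets G. x I)" by auto
  have fV: "finite (pverts G)" and fin: "finite (independent_sets G)"
    using simple_graphD[OF G] finite_independent_sets by auto
  have "(\<Sum>v\<in>pverts G. w v) \<le> (\<Sum>v\<in>pverts G. w v * (\<Sum>I | I \<in> independent_sets G \<and> v \<in> I. x I))"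
  proof (intro sum_mono)
    fix v assume v: "v \<in> pverts G"
    then have "1 \<le> (\<Sum>I | I \<in> independent_sets G \<and> v \<in> I. x I)"
      using x by (simp add: fractional_colouring_def)
    from mult_left_mono[OF this w[OF v]]
    show "w v \<le> w v * (\<Sum>I | I \<in> independent_sets G \<and> v \<in> I. x I)" by simp
  qed
  also have "\<dots> = (\<Sum>v\<in>pverts G. \<Sum>I | I \<in> independent_sets G \<and> v \<in> I. w v * x I)"
    by (simp add: sum_distrib_left)
  also have "\<dots> = (\<Sum>I\<in>independent_sets G. \<Sum>v | v \<in> pverts G \<and> v \<in> I. w v * x I)"
    using fV fin by (rule sum.swap_restrict)
  also have "\<dots> = (\<Sum>I\<in>independent_sets G. x I * (\<Sum>v\<in>I. w v))"
  proof (intro sum.cong refl)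
    fix I assume "I \<in> independent_sets G"
    then have "{v. v \<in> pverts G \<and> v \<in> I} = I" by (auto simp: independent_sets_def)
    then show "(\<Sum>v | v \<in> pverts G \<and> v \<in> I. w v * x I) = x I * (\<Sum>v\<in>I. w v)"
      by (simp add: sum_distrib_left mult.commute)
  qed
  also have "\<dots> \<le> (\<Sum>I\<in>independent_sets G. x I * a)"
    using x a by (intro sum_mono mult_left_mono) (auto simp: fractional_colouring_def)
  also have "\<dots> = c * a" by (simp add: c sum_distrib_right)
  finally show "(\<Sum>v\<in>pverts G. w v) / a \<le> c" using a by (simp add: divide_le_eq)
qed

section \<open>Invariance under isomorphism\<close>

definition map_graph :: "('a \<Rightarrow> 'b) \<Rightarrow> 'a pair_pre_digraph \<Rightarrow> 'b pair_pre_digraph" where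
  "map_graph f G = \<lparr>pverts = f ` pverts G, parcs = map_prod f f ` parcs G\<rparr>"

lemma map_graph_sel [simp]:
  "pverts (map_graph f G) = f ` pverts G" "parcs (map_graph f G) = map_prod f f ` parcs G"
  by (simp_all add: map_graph_def)

lemma map_graph_inverse:
  assumes "finite_simple_graph G" "inj_on f (pverts G)"
  shows "map_graph (inv_into (pverts G) f) (map_graph f G) = G"
proof -
  let ?g = "inv_into (pverts G) f"
  have "map_prod ?g ?g ` map_prod f f ` parcs G = (\<lambda>e. e) ` parcs G"
    unfolding image_image using simple_graphD(3)[OF assms(1)] assms(2)
    by (intro image_cong) auto
  then show ?thesis using assms by (simp add: map_graph_def image_image)
qed

lemma finite_simple_graph_map:
  assumes G: "finite_simple_graph G" and f: "inj_on f (pverts G)"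
  shows "finite_simple_graph (map_graph f G)"
  unfolding map_graph_def
proof (rule simple_graphI)
  show "sym (map_prod f f ` parcs G)"
    using simple_graphD(4)[OF G] by (force simp: sym_def)
  show "irrefl (map_prod f f ` parcs G)"
    using simple_graphD(3,5)[OF G] f by (fastforce simp: irrefl_def inj_on_def)
qed (use simple_graphD[OF G] in auto)

lemma map_graph_arc_iff:
  assumes "finite_simple_graph G" "inj_on f (pverts G)" "u \<in> pverts G" "v \<in> pverts G"
  shows "(f u, f v) \<in> map_prod f f ` parcs G \<longleftrightarrow> (u, v) \<in> parcs G"
  using inj_on_image_mem_iff[OF map_prod_inj_on[OF assms(2,2)], of "(u, v)" "parcs G"]
    simple_graphD(3)[OF assms(1)] assms(3,4) by simp

lemma independent_sets_map:
  assumes "finite_simple_graph G" "inj_on f (pverts G)"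
  shows "independent_sets (map_graph f G) = (`) f ` independent_sets G"
proof -
  have key: "f ` I \<in> independent_sets (map_graph f G) \<longleftrightarrow> I \<in> independent_sets G"
    if I: "I \<subseteq> pverts G" for I
  proof -
    have "(\<forall>u\<in>I. \<forall>v\<in>I. (f u, f v) \<notin> map_prod f f ` parcs G) \<longleftrightarrow> (\<forall>u\<in>I. \<forall>v\<in>I. (u, v) \<notin> parcs G)"
      using map_graph_arc_iff[OF assms] I by (meson subsetD)
    moreover have "f ` I \<subseteq> f ` pverts G" using I by (rule image_mono)
    ultimately show ?thesis
      unfolding independent_sets_def mem_Collect_eq map_graph_sel ball_simps(9) using I by argo
  qed
  show ?thesis
  proof (intro equalityI subsetI)
    fix J assume J: "J \<in> independent_sets (map_graph f G)"
    then have "J \<subseteq> f ` pverts G" unfolding independent_sets_def by simp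
    then obtain I where "I \<subseteq> pverts G" "J = f ` I" by (rule subset_imageE)
    then show "J \<in> (`) f ` independent_sets G" using J key by blast
  next
    fix J assume "J \<in> (`) f ` independent_sets G"
    then obtain I where I: "J = f ` I" "I \<in> independent_sets G" by (rule imageE)
    then have "I \<subseteq> pverts G" unfolding independent_sets_def by simp
    then show "J \<in> independent_sets (map_graph f G)" using I key by simp
  qed
qed

lemma independence_number_map:
  assumes "finite_simple_graph G" "inj_on f (pverts G)"
  shows "independence_number (map_graph f G) = independence_number G"
proof -
  have "card (f ` I) = card I" if "I \<in> independent_sets G" for I
    using that assms(2) by (intro card_image) (auto simp: independent_sets_def intro: inj_on_subset)
  then show ?thesis
    unfolding independence_number_def independent_sets_map[OF assms] image_image
    by (metis (no_types, lifting) image_cong)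
qed

text \<open>A colouring is pulled back along the inverse of \<open>f\<close>. The reverse inclusion is the same statement
for the inverse map.\<close>

lemma fractional_colouring_map:
  assumes G: "finite_simple_graph G" and f: "inj_on f (pverts G)"
  shows "{\<Sum>I\<in>independent_sets G. x I | x. fractional_colouring G x}
    \<subseteq> {\<Sum>I\<in>independent_sets (map_graph f G). x I | x. fractional_colouring (map_graph f G) x}"
proof
  fix c assume "c \<in> {\<Sum>I\<in>independent_sets G. x I | x. fractional_colouring G x}"
  then obtain x where x: "fractional_colouring G x" and c: "c = (\<Sum>I\<in>independent_sets G. x I)" by auto
  (* Intersecting with pverts G makes y (f ` I) = x I for every independent set I. *)
  define y where "y J = x {v \<in> pverts G. f v \<in> J}" for J
  have y: "y (f ` I) = x I" if "I \<in> independent_sets G" for I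
  proof -
    have "{v \<in> pverts G. f v \<in> f ` I} = I"
      using that f by (auto simp: independent_sets_def dest: inj_onD)
    then show ?thesis by (simp add: y_def)
  qed
  have inj: "inj_on ((`) f) A" if "A \<subseteq> independent_sets G" for A
    using that f by (intro inj_onI) (auto simp: independent_sets_def inj_on_image_eq_iff subset_iff)
  have sum_eq: "(\<Sum>J\<in>(`) f ` A. y J) = (\<Sum>I\<in>A. x I)" if "A \<subseteq> independent_sets G" for A
    using inj[OF that] that y by (subst sum.reindex) (auto intro!: sum.cong)
  have "1 \<le> (\<Sum>J | J \<in> (`) f ` independent_sets G \<and> f v \<in> J. y J)" if v: "v \<in> pverts G" for v
  proof -
    have "{J \<in> (`) f ` independent_sets G. f v \<in> J} = (`) f ` {I \<in> independent_sets G. v \<in> I}"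
      using v f by (auto simp: independent_sets_def dest: inj_onD)
    then have "(\<Sum>J | J \<in> (`) f ` independent_sets G \<and> f v \<in> J. y J) =
        (\<Sum>I | I \<in> independent_sets G \<and> v \<in> I. x I)"
      using sum_eq[of "{I \<in> independent_sets G. v \<in> I}"] by auto
    then show ?thesis using x v by (simp add: fractional_colouring_def)
  qed
  then have "fractional_colouring (map_graph f G) y"
    using x y by (auto simp: fractional_colouring_def independent_sets_map[OF G f])
  moreover have "c = (\<Sum>J\<in>independent_sets (map_graph f G). y J)"
    unfolding c independent_sets_map[OF G f] using sum_eq[of "independent_sets G"] by simp
  ultimately show "c \<in> {\<Sum>I\<in>independent_sets (map_graph f G). x I | x. fractional_colouring (map_graph f G) x}"
    by auto
qed

lemma fractional_chromatic_number_map: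
  assumes "finite_simple_graph G" "inj_on f (pverts G)"
  shows "fractional_chromatic_number (map_graph f G) = fractional_chromatic_number G"
proof -
  have "inj_on (inv_into (pverts G) f) (pverts (map_graph f G))" by (simp add: inj_on_inv_into)
  note inverse_le = fractional_colouring_map[OF finite_simple_graph_map[OF assms] this,
      unfolded map_graph_inverse[OF assms]]
  show ?thesis
    unfolding fractional_chromatic_number_def
    by (rule arg_cong[OF subset_antisym[OF inverse_le fractional_colouring_map[OF assms]]])
qed

lemma hall_ratio_map:
  assumes G: "finite_simple_graph G" and f: "inj_on f (pverts G)"
  shows "hall_ratio (map_graph f G) = hall_ratio G"
proof -
  have le: "hall_ratio G \<le> hall_ratio (map_graph f G)"
    if G: "finite_simple_graph G" and f: "inj_on f (pverts G)"
    for G :: "'c pair_pre_digraph" and f :: "'c \<Rightarrow> 'd"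
  proof (rule hall_ratio_le[OF G])
    fix H assume H: "finite_simple_graph H" "pverts H \<subseteq> pverts G" "parcs H \<subseteq> parcs G"
    have fH: "inj_on f (pverts H)" using f H(2) by (rule inj_on_subset)
    show "real (card (pverts H)) \<le> hall_ratio (map_graph f G) * real (independence_number H)"
      using hall_ratio_ge[OF finite_simple_graph_map[OF G f] finite_simple_graph_map[OF H(1) fH]] H
        independence_number_bounds[OF H(1)] fH
      by (auto simp: independence_number_map card_image divide_le_eq image_mono)
  qed
  show ?thesis
    using le[OF G f] le[OF finite_simple_graph_map[OF assms], of "inv_into (pverts G) f"]
    by (simp add: map_graph_inverse[OF assms] inj_on_inv_into)
qed

text \<open>Every graph with \<open>n\<close> vertices is isomorphic to one of the finitely many graphs on \<open>{..<n}\<close>.\<close>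

lemma finite_chi_hall_ratios:
  "finite {fractional_chromatic_number G / hall_ratio G | G :: nat pair_pre_digraph. n_vertex_graph n G}"
proof (rule finite_subset)
  let ?\<G> = "(\<lambda>R. \<lparr>pverts = {..<n}, parcs = R\<rparr>) ` Pow ({..<n} \<times> {..<n})"
  let ?r = "\<lambda>G :: nat pair_pre_digraph. fractional_chromatic_number G / hall_ratio G"
  show "finite (?r ` ?\<G>)" by simp
  show "{?r G | G. n_vertex_graph n G} \<subseteq> ?r ` ?\<G>"
  proof
    fix c assume "c \<in> {?r G | G. n_vertex_graph n G}"
    then obtain G :: "nat pair_pre_digraph" where G: "c = ?r G" "finite_simple_graph G" "card (pverts G) = n"
      by (auto simp: n_vertex_graph_def)
    obtain f where f: "bij_betw f (pverts G) {..<n}"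
      using ex_bij_betw_finite_nat[of "pverts G"] simple_graphD[OF G(2)] G(3) by (auto simp: atLeast0LessThan)
    have "c = ?r (map_graph f G)"
      using f G by (simp add: fractional_chromatic_number_map hall_ratio_map bij_betw_def)
    moreover have "map_graph f G \<in> ?\<G>"
    proof (rule image_eqI)
      have V: "f ` pverts G = {..<n}" using f by (simp add: bij_betw_def)
      show "map_graph f G = \<lparr>pverts = {..<n}, parcs = map_prod f f ` parcs G\<rparr>"
        by (simp add: map_graph_def V)
      have "map_prod f f ` parcs G \<subseteq> map_prod f f ` (pverts G \<times> pverts G)"
        by (rule image_mono[OF simple_graphD(3)[OF G(2)]])
      also have "\<dots> = {..<n} \<times> {..<n}" by (rule map_prod_surj_on[OF V V])
      finally show "map_prod f f ` parcs G \<in> Pow ({..<n} \<times> {..<n})" by simp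
    qed
    ultimately show "c \<in> ?r ` ?\<G>" by (rule image_eqI)
  qed
qed

section \<open>The construction on a prescribed number of vertices\<close>

lemma exists_level_function:
  "(\<Sum>i<k. c i) \<le> card X \<Longrightarrow> finite X \<Longrightarrow>
    \<exists>lev :: 'a \<Rightarrow> nat. \<forall>i<k. card {v \<in> X. lev v = i} = c i"
proof (induction k arbitrary: c X)
  case (Suc k)
  have "c 0 \<le> card X" using Suc.prems by (simp add: sum.lessThan_Suc_shift del: sum.lessThan_Suc)
  then obtain Y where Y: "Y \<subseteq> X" "card Y = c 0" by (rule obtain_subset_with_card_n)
  have "(\<Sum>i<k. c (Suc i)) \<le> card (X - Y)"
    using Suc.prems Y by (simp del: sum.lessThan_Suc add: sum.lessThan_Suc_shift card_Diff_subset finite_subset)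
  from Suc.IH[OF this] Suc.prems
  obtain lev where lev: "\<forall>i<k. card {v \<in> X - Y. lev v = i} = c (Suc i)" by auto
  have "card {v \<in> X. (if v \<in> Y then 0 else Suc (lev v)) = i} = c i" if "i < Suc k" for i
  proof (cases i)
    case 0
    then have "{v \<in> X. (if v \<in> Y then 0 else Suc (lev v)) = i} = Y" using Y by auto
    then show ?thesis using Y 0 by simp
  next
    case (Suc j)
    then have "{v \<in> X. (if v \<in> Y then 0 else Suc (lev v)) = i} = {v \<in> X - Y. lev v = j}" by auto
    then show ?thesis using lev Suc that by simp
  qed
  then show ?case by (intro exI[of _ "\<lambda>v. if v \<in> Y then 0 else Suc (lev v)"]) blast
qed auto

lemma exists_graph_with_parameters:
  assumes k: "1 \<le> k" "k < 2 ^ L" and n: "(\<Sum>i<k. (8 * k) ^ Suc i) \<le> n"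
  shows "\<exists>G :: nat pair_pre_digraph. n_vertex_graph n G \<and>
    real k / 3 \<le> fractional_chromatic_number G \<and> hall_ratio G \<le> 8 * real (L + 1)"
proof -
  obtain lev :: "nat \<Rightarrow> nat" where lev: "\<forall>i<k. card {v \<in> {..<n}. lev v = i} = (8 * k) ^ Suc i"
    using exists_level_function[of "\<lambda>i. (8 * k) ^ Suc i" k "{..<n}"] n by auto
  interpret levelled_set "{..<n}" lev "8 * k" k
    by unfold_locales (use lev k in auto)
  obtain E where E: "E \<subseteq> candidates"
    and hit: "\<forall>j<k. \<forall>S B. S \<subseteq> {v \<in> {..<n}. lev v < j} \<longrightarrow> B \<subseteq> level j \<longrightarrow>
      (8 * k) ^ Suc j \<le> k * card B \<longrightarrow> 1 \<le> weight S \<longrightarrow> (S \<times> B) \<inter> E \<noteq> {}"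
    and sparse: "\<forall>q u T. 3 \<le> u \<longrightarrow> T \<subseteq> block q u \<longrightarrow> T \<noteq> {} \<longrightarrow> card T \<le> (8 * k) ^ q \<longrightarrow>
        card (E \<inter> T \<times> T) < 3 * card T"
    using exists_good_edges by (elim exE conjE)
  let ?G = "\<lparr>pverts = {..<n}, parcs = E \<union> E\<inverse>\<rparr>"
  have "(8 * k) ^ Suc 0 \<le> n"
    using k(1) by (intro order.trans[OF member_le_sum n]) auto
  then have "n \<noteq> 0" using k(1) by auto
  then have G: "finite_simple_graph ?G"
    using E by (intro simple_graphI) (auto simp: candidates_def irrefl_def intro!: symI)
  define w where "w v = (if lev v < k then 1 / real (8 * k) ^ Suc (lev v) else 0)" for v
  have w: "(\<Sum>v\<in>A. w v) = weight {v \<in> A. lev v < k}" if "finite A" for A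
    unfolding weight_def w_def using that by (simp add: sum.If_cases Int_def)
  have "(\<Sum>v\<in>pverts ?G. w v) / 3 \<le> fractional_chromatic_number ?G"
  proof (rule fractional_chromatic_number_ge_weight[OF G])
    fix I assume "I \<in> independent_sets ?G"
    then have I: "I \<subseteq> {..<n}" "\<And>u v. u \<in> I \<Longrightarrow> v \<in> I \<Longrightarrow> (u, v) \<notin> E"
      by (auto simp: independent_sets_def)
    have "weight {v \<in> I. lev v < k} \<le> 3"
      by (rule independent_weight_le[OF _ I]) (use hit in blast)
    then show "(\<Sum>v\<in>I. w v) \<le> 3" using w I(1) by (simp add: finite_subset[OF I(1)])
  qed (auto simp: w_def)
  then have "real k / 3 \<le> fractional_chromatic_number ?G"
    using w[of "{..<n}"] weight_X by simp
  moreover have "hall_ratio ?G \<le> 8 * real (L + 1)"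
  proof (rule hall_ratio_le[OF G])
    fix H assume H: "finite_simple_graph H" "pverts H \<subseteq> pverts ?G" "parcs H \<subseteq> parcs ?G"
    have "card (pverts H) \<le> 8 * (L + 1) * independence_number H"
    proof (rule large_independent_subset[OF E _ _ _ k(2)])
      fix I assume "I \<subseteq> pverts H" "\<forall>u\<in>I. \<forall>v\<in>I. (u, v) \<notin> E"
      then show "card I \<le> independence_number H"
        using H simple_graphD(1)[OF H(1)]
        by (intro card_le_independence_number) (auto simp: independent_sets_def)
    qed (use sparse H in auto)
    from of_nat_mono[OF this, where 'a = real]
    show "real (card (pverts H)) \<le> 8 * real (L + 1) * real (independence_number H)"
      by simp
  qed
  ultimately show ?thesis using G by (intro exI[of _ ?G]) (simp add: n_vertex_graph_def)
qed

lemma geometric_sum_le_twice_last: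
  fixes b :: nat
  assumes "2 \<le> b" shows "(\<Sum>i<k. b ^ Suc i) \<le> 2 * b ^ k"
proof (induction k)
  case (Suc k)
  have "2 * b ^ k \<le> b * b ^ k" using assms by (intro mult_right_mono) auto
  then show ?case using Suc unfolding sum.lessThan_Suc power_Suc by linarith
qed simp

text \<open>The choice is \<open>k = \<lfloor>x / (2 * y)\<rfloor>\<close> with \<open>x = ln n\<close> and \<open>y = ln x\<close>: then \<open>16 * k \<le> x\<close>, so that the
number of vertices in the \<open>k\<close> levels is at most \<open>(16 * k) ^ k \<le> exp (k * y) \<le> n\<close>.\<close>

lemma exists_graph_large_chi_small_hall:
  fixes n :: nat
  assumes y: "8 \<le> ln (ln (real n))" and x: "2 * ln (ln (real n)) \<le> ln (real n)"
  shows "\<exists>G :: nat pair_pre_digraph. n_vertex_graph n G \<and>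
    ln (real n) / (12 * ln (ln (real n))) \<le> fractional_chromatic_number G \<and>
    hall_ratio G \<le> 32 * ln (ln (real n))"
proof -
  define x where "x = ln (real n)"
  define y where "y = ln x"
  have y8: "8 \<le> y" and xy: "2 * y \<le> x" using assms by (simp_all add: x_def y_def)
  have n0: "n \<noteq> 0" using xy y8 by (intro notI) (simp add: x_def)
  define k where "k = nat \<lfloor>x / (2 * y)\<rfloor>"
  have ratio: "1 \<le> x / (2 * y)" using xy y8 by (simp add: le_divide_eq)
  then have k1: "1 \<le> k" unfolding k_def by (simp add: le_nat_iff le_floor_iff)
  have k_le: "real k \<le> x / (2 * y)" unfolding k_def using ratio by simp
  have k_ge: "x / (4 * y) \<le> real k"
  proof -
    have "x / (2 * y) < real k + 1" unfolding k_def using ratio by linarith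
    then have "x / (2 * y) \<le> 2 * real k" using k1 by linarith
    then show ?thesis using y8 by (simp add: field_simps)
  qed
  have x0: "0 < x" using xy y8 by linarith
  have "16 * real k \<le> x"
  proof -
    have "16 * real k * y \<le> 8 * x" using k_le y8 by (simp add: field_simps)
    also have "\<dots> \<le> x * y" using mult_left_mono[OF y8, of x] x0 by (simp add: mult.commute)
    finally show ?thesis using y8 by simp
  qed
  then have ln16k: "ln (16 * real k) \<le> y" using k1 x0 unfolding y_def by (subst ln_le_cancel_iff) auto
  have "(\<Sum>i<k. (8 * k) ^ Suc i) \<le> 2 * (8 * k) ^ k" using k1 by (intro geometric_sum_le_twice_last) simp
  also have "\<dots> \<le> (16 * k) ^ k"
  proof -
    have "2 * (8 * k) ^ k \<le> 2 ^ k * (8 * k) ^ k" using k1 by (intro mult_right_mono self_le_power) auto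
    also have "\<dots> = (2 * (8 * k)) ^ k" by (rule power_mult_distrib[symmetric])
    also have "2 * (8 * k) = 16 * k" by simp
    finally show ?thesis .
  qed
  also have "\<dots> \<le> n"
  proof -
    have "real ((16 * k) ^ k) = exp (real k * ln (16 * real k))"
      using k1 by (simp only: exp_of_nat_mult) simp
    also have "\<dots> \<le> exp (x / (2 * y) * y)"
      using k_le ln16k k1 y8 by (intro iffD2[OF exp_le_cancel_iff] mult_mono) auto
    also have "\<dots> \<le> exp x" using y8 x0 by simp
    also have "\<dots> = real n" using n0 by (simp add: x_def)
    finally show ?thesis by linarith
  qed
  finally have size: "(\<Sum>i<k. (8 * k) ^ Suc i) \<le> n" .
  obtain m where m: "2 ^ m \<le> k" "k < 2 ^ (m + 1)" using ex_power_ivl1[of 2 k] k1 by auto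
  obtain G :: "nat pair_pre_digraph" where G: "n_vertex_graph n G"
    "real k / 3 \<le> fractional_chromatic_number G" "hall_ratio G \<le> 8 * real (m + 1 + 1)"
    using exists_graph_with_parameters[OF k1 m(2) size] by auto
  have "1 / 2 \<le> ln (2 :: real)" using exp_half_le2 iffD2[OF ln_ge_iff, of 2 "1 / 2"] by simp
  then have "real m / 2 \<le> real m * ln 2" using mult_left_mono[of "1 / 2" "ln 2" "real m"] by simp
  also have "\<dots> = ln (2 ^ m)" by (simp add: ln_realpow)
  also have "\<dots> \<le> ln (16 * real k)"
  proof -
    have "(2::real) ^ m \<le> real k" using m(1) by (metis of_nat_le_iff of_nat_numeral of_nat_power)
    then have "(2::real) ^ m \<le> 16 * real k" by linarith
    then show ?thesis using k1 by (subst ln_le_cancel_iff) auto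
  qed
  finally have "real m \<le> 2 * y" using ln16k by linarith
  then have "hall_ratio G \<le> 32 * y" using G(3) y8 by simp
  moreover have "x / (12 * y) \<le> fractional_chromatic_number G"
    using k_ge G(2) by simp
  ultimately show ?thesis using G(1) unfolding x_def y_def by blast
qed

section \<open>The asymptotic growth of the largest ratio\<close>

lemma max_chi_hall_ratio_le:
  fixes G :: "nat pair_pre_digraph"
  assumes "n_vertex_graph n G"
  shows "max_chi_hall_ratio n \<le> 1 + ln (real n)"
proof -
  let ?S = "{fractional_chromatic_number G / hall_ratio G | G :: nat pair_pre_digraph. n_vertex_graph n G}"
  have "?S \<noteq> {}" using assms by blast
  moreover have "c \<le> 1 + ln (real n)" if "c \<in> ?S" for c
  proof -
    from that obtain G :: "nat pair_pre_digraph" where G: "n_vertex_graph n G"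
      and c: "c = fractional_chromatic_number G / hall_ratio G" by blast
    have "fractional_chromatic_number G \<le> hall_ratio G * (1 + ln (real n))" "1 \<le> hall_ratio G"
      using fractional_chromatic_number_le_hall_ratio[of G] hall_ratio_ge_1[of G] G
      by (auto simp: n_vertex_graph_def)
    then show ?thesis unfolding c by (simp add: divide_le_eq mult.commute)
  qed
  ultimately show ?thesis
    unfolding max_chi_hall_ratio_def by (rule Max.boundedI[OF finite_chi_hall_ratios])
qed

lemma max_chi_hall_ratio_ge:
  fixes G :: "nat pair_pre_digraph"
  assumes "n_vertex_graph n G"
  shows "fractional_chromatic_number G / hall_ratio G \<le> max_chi_hall_ratio n"
  unfolding max_chi_hall_ratio_def using assms by (intro Max_ge[OF finite_chi_hall_ratios]) blast

lemma eventually_large_chi_small_hall: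
  "\<forall>\<^sub>F n in sequentially. \<exists>G :: nat pair_pre_digraph. n_vertex_graph n G \<and>
    ln (real n) / (12 * ln (ln (real n))) \<le> fractional_chromatic_number G \<and>
    hall_ratio G \<le> 32 * ln (ln (real n))"
proof -
  have "\<forall>\<^sub>F n in sequentially. 8 \<le> ln (ln (real n))" by real_asymp
  moreover have "\<forall>\<^sub>F n in sequentially. 2 * ln (ln (real n)) \<le> ln (real n)" by real_asymp
  ultimately show ?thesis by eventually_elim (rule exists_graph_large_chi_small_hall)
qed

lemma eventually_max_chi_hall_ratio_bounds:
  "\<forall>\<^sub>F n in sequentially. ln (real n) / (384 * (ln (ln (real n)))\<^sup>2) \<le> max_chi_hall_ratio n \<and>
    max_chi_hall_ratio n \<le> 1 + ln (real n)"
proof -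
  have "\<forall>\<^sub>F n in sequentially. 1 \<le> ln (ln (real n))" by real_asymp
  moreover have "\<forall>\<^sub>F n in sequentially. 1 \<le> ln (real n)" by real_asymp
  ultimately show ?thesis using eventually_large_chi_small_hall
  proof eventually_elim
    case (elim n)
    then obtain G :: "nat pair_pre_digraph" where G: "n_vertex_graph n G"
      "ln (real n) / (12 * ln (ln (real n))) \<le> fractional_chromatic_number G"
      "hall_ratio G \<le> 32 * ln (ln (real n))" by blast
    have "1 \<le> hall_ratio G" using G(1) hall_ratio_ge_1 by (auto simp: n_vertex_graph_def)
    then have "ln (real n) / (12 * ln (ln (real n))) / (32 * ln (ln (real n)))
        \<le> fractional_chromatic_number G / hall_ratio G"
      using G elim by (intro frac_le) (auto intro: order.trans[OF _ G(2)])
    also have "\<dots> \<le> max_chi_hall_ratio n" by (rule max_chi_hall_ratio_ge[OF G(1)])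
    finally show ?case using max_chi_hall_ratio_le[OF G(1)] by (simp add: power2_eq_square mult_ac)
  qed
qed

theorem theorem1p3:
  shows "(\<exists>C::real. C > 0 \<and>
            (\<forall>\<^sub>F n::nat in sequentially. \<exists>G :: nat pair_pre_digraph.
               n_vertex_graph n G \<and>
               fractional_chromatic_number G \<ge> ln (real n) / (C * ln (ln (real n))) \<and>
               hall_ratio G \<le> C * (ln (ln (real n)))\<^sup>2)) \<and>
         max_chi_hall_ratio \<in> \<Omega>(\<lambda>n. ln (real n) / (ln (ln (real n))) ^ 3) \<and>
         (\<exists>\<epsilon> :: nat \<Rightarrow> real. \<epsilon> \<in> o(\<lambda>_. 1) \<and>
            (\<forall>\<^sub>F n::nat in sequentially. max_chi_hall_ratio n = ln (real n) powr (1 - \<epsilon> n)))"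
proof (intro conjI)
  have large: "\<forall>\<^sub>F n in sequentially. 1 \<le> ln (ln (real n)) \<and> 1 < ln (real n)"
    by (intro eventually_conj) real_asymp+
  show "\<exists>C::real. C > 0 \<and>
      (\<forall>\<^sub>F n::nat in sequentially. \<exists>G :: nat pair_pre_digraph. n_vertex_graph n G \<and>
         fractional_chromatic_number G \<ge> ln (real n) / (C * ln (ln (real n))) \<and>
         hall_ratio G \<le> C * (ln (ln (real n)))\<^sup>2)"
  proof (intro exI[of _ 32] conjI)
    show "\<forall>\<^sub>F n::nat in sequentially. \<exists>G :: nat pair_pre_digraph. n_vertex_graph n G \<and>
         fractional_chromatic_number G \<ge> ln (real n) / (32 * ln (ln (real n))) \<and>
         hall_ratio G \<le> 32 * (ln (ln (real n)))\<^sup>2"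
      using large eventually_large_chi_small_hall
    proof eventually_elim
      case (elim n)
      let ?y = "ln (ln (real n))"
      have "0 < ?y" "0 \<le> ln (real n)" using elim by linarith+
      then have "ln (real n) / (32 * ?y) \<le> ln (real n) / (12 * ?y)"
        by (intro divide_left_mono) (auto intro: mult_pos_pos)
      moreover have "32 * ?y \<le> 32 * ?y\<^sup>2" using elim self_le_power[of ?y 2] by simp
      ultimately show ?case using elim by (meson order.trans)
    qed
  qed simp
  show "max_chi_hall_ratio \<in> \<Omega>(\<lambda>n. ln (real n) / (ln (ln (real n))) ^ 3)"
  proof (rule landau_omega.bigI[of "1 / 384"])
    show "\<forall>\<^sub>F n in sequentially. 1 / 384 * norm (ln (real n) / ln (ln (real n)) ^ 3)
        \<le> norm (max_chi_hall_ratio n)"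
      using large eventually_max_chi_hall_ratio_bounds
    proof eventually_elim
      case (elim n)
      let ?y = "ln (ln (real n))"
      have "1 / 384 * norm (ln (real n) / ?y ^ 3) = ln (real n) / (384 * ?y ^ 3)"
        using elim by simp
      also have "\<dots> \<le> ln (real n) / (384 * ?y\<^sup>2)"
        using elim by (intro divide_left_mono mult_left_mono power_increasing) auto
      also have "\<dots> \<le> norm (max_chi_hall_ratio n)"
        using elim by (auto intro: order.trans[OF _ abs_ge_self])
      finally show ?case .
    qed
  qed simp
  (* With this choice the required identity holds as soon as the ratio is positive; that
     \<epsilon> vanishes is what the two bounds on the ratio are needed for. *)
  define \<epsilon> where "\<epsilon> n = 1 - ln (max_chi_hall_ratio n) / ln (ln (real n))" for n
  have pos: "\<forall>\<^sub>F n in sequentially. 0 < max_chi_hall_ratio n"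
    using large eventually_max_chi_hall_ratio_bounds
  proof eventually_elim
    case (elim n)
    then have "0 < ln (real n) / (384 * (ln (ln (real n)))\<^sup>2)" by (intro divide_pos_pos) auto
    then show ?case using elim by linarith
  qed
  have "\<epsilon> \<longlonglongrightarrow> 0"
  proof (rule tendsto_sandwich)
    show "\<forall>\<^sub>F n in sequentially. 1 - ln (1 + ln (real n)) / ln (ln (real n)) \<le> \<epsilon> n"
      using large eventually_max_chi_hall_ratio_bounds pos
      by eventually_elim (auto simp: \<epsilon>_def intro!: divide_right_mono)
    show "\<forall>\<^sub>F n in sequentially. \<epsilon> n \<le>
        1 - ln (ln (real n) / (384 * (ln (ln (real n)))\<^sup>2)) / ln (ln (real n))"
      using large eventually_max_chi_hall_ratio_bounds pos
    proof eventually_elim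
      case (elim n)
      then have "0 < ln (real n) / (384 * (ln (ln (real n)))\<^sup>2)" by (intro divide_pos_pos) auto
      moreover have "0 < max_chi_hall_ratio n"
        "ln (real n) / (384 * (ln (ln (real n)))\<^sup>2) \<le> max_chi_hall_ratio n"
        using elim by blast+
      ultimately have "ln (ln (real n) / (384 * (ln (ln (real n)))\<^sup>2)) \<le> ln (max_chi_hall_ratio n)"
        by (rule iffD2[OF ln_le_cancel_iff])
      then show ?case using elim by (simp add: \<epsilon>_def divide_right_mono)
    qed
    show "(\<lambda>n. 1 - ln (1 + ln (real n)) / ln (ln (real n))) \<longlonglongrightarrow> 0" by real_asymp
    show "(\<lambda>n. 1 - ln (ln (real n) / (384 * (ln (ln (real n)))\<^sup>2)) / ln (ln (real n))) \<longlonglongrightarrow> 0"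
      by real_asymp
  qed
  then have "\<epsilon> \<in> o(\<lambda>_. 1)" by (intro smalloI_tendsto) auto
  moreover have "\<forall>\<^sub>F n in sequentially. max_chi_hall_ratio n = ln (real n) powr (1 - \<epsilon> n)"
    using large pos
  proof eventually_elim
    case (elim n)
    then show ?case by (simp add: \<epsilon>_def powr_def)
  qed
  ultimately show "\<exists>\<epsilon> :: nat \<Rightarrow> real. \<epsilon> \<in> o(\<lambda>_. 1) \<and>
      (\<forall>\<^sub>F n::nat in sequentially. max_chi_hall_ratio n = ln (real n) powr (1 - \<epsilon> n))"
    by blast
qed

end
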